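(* Let $P_1,P_2$ be non-commutative Poisson algebras over $K$ of the same class (both of Class 1 or both of Class 2), with degree maps $u_i:P_i\to\mathbb Z_{\ge0}\cup\{-\infty\}$ ($i=1,2$) whose induced filtrations are finite and discrete. Assume that the associated graded non-commutative Poisson algebras $gr\,P_1$ and $gr\,P_2$ are both commutative under their Poisson brackets (i.e. their brackets vanish identically). Let $z_1\in P_1\setminus Z(P_1)$, $z_2\in P_2\setminus Z(P_2)$ and $\Theta=z_1\otimes z_2\in P_1\otimes P_2$. Then $$F(\Theta)=N(\Theta)=N(z_1)\otimes N(z_2),\qquad D(\Theta)=C(\Theta),\qquad Ev(\Theta)=\{0\}.$$
   Context: $K$ is an algebraically closed field of characteristic zero; tensor products are over $K$. A non-commutative Poisson algebra over $K$ is a $K$-vector space $P$ with a bilinear product $\cdot$ making it a unital associative (not necessarily commutative) $K$-algebra and a bilinear bracket $\{\cdot,\cdot\}$ making it a Lie algebra, such that $\{x,yz\}=\{x,y\}z+y\{x,z\}$ for all $x,y,z\in P$. It is of Class 1 if $(P,\cdot)$ is commutative, and of Class 2 if $(P,\cdot)$ is non-commutative and $\{a,b\}=ab-ba$ for all $a,b$. $Z(P)$ is the set of elements central for both the product and the bracket; for Class 1 or 2, $Z(P)=\{z\mid \{z,w\}=0\ \forall w\in P\}$. Tensor product: if $P_1,P_2$ are both of Class 1, $P_1\otimes P_2$ carries the bracket $\{a_1\otimes a_2,b_1\otimes b_2\}=\{a_1,b_1\}\otimes a_2b_2+b_1a_1\otimes\{a_2,b_2\}$; if both are of Class 2, the bracket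 on $P_1\otimes P_2$ is the commutator. This makes $P_1\otimes P_2$ a non-commutative Poisson algebra of the same class. A degree map on $P$ is a map $u:P\to\mathbb Z\cup\{-\infty\}$ such that for all $z,w\in P$: $u(\{z,w\})\le u(zw)=u(z)+u(w)$; $u(z+w)\le\max\{u(z),u(w)\}$; $u(z)=-\infty$ iff $z=0$. Its induced filtration is $P_t=\{a\in P\mid u(a)\le t\}$, $t\in\mathbb Z$; it is finite if every $P_t$ is finite dimensional over $K$ and discrete if $P_t=\{0\}$ for all $t<0$. The associated graded algebra is $gr\,P=\bigoplus_{i}P_i/P_{i-1}$ with $(x+P_{i-1})(y+P_{j-1})=xy+P_{i+j-1}$ and $\{x+P_{i-1},y+P_{j-1}\}=\{x,y\}+P_{i+j-1}$ for $x\in P_i,y\in P_j$. For an element $z$ of a non-commutative Poisson algebra $P$ put $ad_z(w)=\{z,w\}$ and $Ev(z)=\{\lambda\in K\mid \exists x\in P\setminus\{0\},\ ad_z(x)=\lambda x\}$, $F(z)=\{x\in P\mid \dim_K K[ad_z](x)<\infty\}$, $N(z)=\{x\in P\mid \exists m,\ ad_z^m(x)=0\}$, $C(z)=\{x\in P\mid ad_z(x)=0\}$, $D(z)=\bigoplus_{\lambda\in Ev(z)}\{x\in P\mid ad_z(x)=\lambda x\}$. For $z_i$ these are formed in $P_i$; for $\Theta$ they are formed in $P_1\otimes P_2$. *)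

theory Defs
  imports
    "HOL-Computational_Algebra.Computational_Algebra"
    "HOL-Library.Extended"
    "HOL-Library.Poly_Mapping"
begin

section \<open>Non-commutative Poisson algebras\<close>

definition bilinear_map ::
  "('k::field \<Rightarrow> 'a::ab_group_add \<Rightarrow> 'a) \<Rightarrow> ('k \<Rightarrow> 'b::ab_group_add \<Rightarrow> 'b) \<Rightarrow>
   ('k \<Rightarrow> 'c::ab_group_add \<Rightarrow> 'c) \<Rightarrow> ('a \<Rightarrow> 'b \<Rightarrow> 'c) \<Rightarrow> bool"
  where "bilinear_map s1 s2 s3 f \<longleftrightarrow>
    (\<forall>x. Vector_Spaces.linear s2 s3 (\<lambda>y. f x y)) \<and>
    (\<forall>y. Vector_Spaces.linear s1 s3 (\<lambda>x. f x y))"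

text \<open>The associative unital ring structure comes from the class \<^class>\<open>ring_1\<close>; the scalar
  multiplication and the bracket are parameters.\<close>

locale nc_poisson_algebra = vector_space scale
  for scale :: "'k::field \<Rightarrow> 'a::ring_1 \<Rightarrow> 'a" +
  fixes br :: "'a \<Rightarrow> 'a \<Rightarrow> 'a"
  assumes bilinear_mult: "bilinear_map scale scale scale (*)"
    and bilinear_br: "bilinear_map scale scale scale br"
    and br_self: "br x x = 0"
    and jacobi: "br x (br y z) + br y (br z x) + br z (br x y) = 0"
    and leibniz: "br x (y * z) = br x y * z + y * br x z"

definition poisson_class1 ::
  "('k::field \<Rightarrow> 'a::ring_1 \<Rightarrow> 'a) \<Rightarrow> ('a \<Rightarrow> 'a \<Rightarrow> 'a) \<Rightarrow> bool"
  where "poisson_class1 s br \<longleftrightarrow> nc_poisson_algebra s br \<and> (\<forall>x y::'a. x * y = y * x)"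

definition poisson_class2 ::
  "('k::field \<Rightarrow> 'a::ring_1 \<Rightarrow> 'a) \<Rightarrow> ('a \<Rightarrow> 'a \<Rightarrow> 'a) \<Rightarrow> bool"
  where "poisson_class2 s br \<longleftrightarrow> nc_poisson_algebra s br \<and>
    \<not> (\<forall>x y::'a. x * y = y * x) \<and> (\<forall>a b. br a b = a * b - b * a)"

definition poisson_center :: "('a::ring_1 \<Rightarrow> 'a \<Rightarrow> 'a) \<Rightarrow> 'a set"
  where "poisson_center br = {z. \<forall>w. z * w = w * z \<and> br z w = 0}"


section \<open>Degree maps and associated graded algebras\<close>

text \<open>\<^typ>\<open>int extended\<close> also contains \<open>\<infinity>\<close>, which is excluded as a value.\<close>

definition degree_map :: "('a::ring_1 \<Rightarrow> 'a \<Rightarrow> 'a) \<Rightarrow> ('a \<Rightarrow> int extended) \<Rightarrow> bool"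
  where "degree_map br u \<longleftrightarrow>
    (\<forall>z. u z \<noteq> \<infinity>) \<and>
    (\<forall>z w. u (br z w) \<le> u (z * w) \<and> u (z * w) = u z + u w) \<and>
    (\<forall>z w. u (z + w) \<le> max (u z) (u w)) \<and>
    (\<forall>z. u z = -\<infinity> \<longleftrightarrow> z = 0)"

definition filt :: "('a \<Rightarrow> int extended) \<Rightarrow> int \<Rightarrow> 'a set"
  where "filt u t = {a. u a \<le> Fin t}"

definition finite_dim :: "('k::field \<Rightarrow> 'a::ab_group_add \<Rightarrow> 'a) \<Rightarrow> 'a set \<Rightarrow> bool"
  where "finite_dim s S \<longleftrightarrow> (\<exists>B. finite B \<and> module.span s B = S)"

definition finite_filtration ::
  "('k::field \<Rightarrow> 'a::ab_group_add \<Rightarrow> 'a) \<Rightarrow> ('a \<Rightarrow> int extended) \<Rightarrow> bool"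
  where "finite_filtration s u \<longleftrightarrow> (\<forall>t. finite_dim s (filt u t))"

definition discrete_filtration :: "('a::zero \<Rightarrow> int extended) \<Rightarrow> bool"
  where "discrete_filtration u \<longleftrightarrow> (\<forall>t<0. filt u t = {0})"

text \<open>The coset \<open>x + P\<^sub>i\<^sub>-\<^sub>1\<close>.\<close>

definition gr_coset :: "('a::ab_group_add \<Rightarrow> int extended) \<Rightarrow> int \<Rightarrow> 'a \<Rightarrow> 'a set"
  where "gr_coset u i x = {x + p | p. p \<in> filt u (i - 1)}"

text \<open>The direct sum of the quotients \<open>P\<^sub>i / P\<^sub>i\<^sub>-\<^sub>1\<close>: families of cosets, almost all of them zero.\<close>

definition gr_zero :: "('a::ab_group_add \<Rightarrow> int extended) \<Rightarrow> int \<Rightarrow> 'a set"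
  where "gr_zero u = (\<lambda>i. filt u (i - 1))"

definition gr_carrier :: "('a::ab_group_add \<Rightarrow> int extended) \<Rightarrow> (int \<Rightarrow> 'a set) set"
  where "gr_carrier u = {X. (\<forall>i. X i \<in> gr_coset u i ` filt u i) \<and> finite {i. X i \<noteq> gr_zero u i}}"

text \<open>The operation induced on the associated graded algebra by a biadditive operation \<open>f\<close>,
  extended biadditively from
  \<open>f (x + P\<^sub>i\<^sub>-\<^sub>1) (y + P\<^sub>j\<^sub>-\<^sub>1) = f x y + P\<^sub>i\<^sub>+\<^sub>j\<^sub>-\<^sub>1\<close>; the result does not depend on the chosen
  representatives, see \<open>gr_op_homogeneous\<close>. It is the graded product for \<open>f = (*)\<close> and the
  graded bracket for \<open>f = br\<close>.\<close>

definition gr_op ::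
  "('a::ab_group_add \<Rightarrow> int extended) \<Rightarrow> ('a \<Rightarrow> 'a \<Rightarrow> 'a) \<Rightarrow>
   (int \<Rightarrow> 'a set) \<Rightarrow> (int \<Rightarrow> 'a set) \<Rightarrow> int \<Rightarrow> 'a set"
  where "gr_op u f X Y = (\<lambda>n. gr_coset u n
    (\<Sum>i | X i \<noteq> gr_zero u i \<and> Y (n - i) \<noteq> gr_zero u (n - i).
       f (SOME x. x \<in> X i) (SOME y. y \<in> Y (n - i))))"

definition gr_bracket_commutative ::
  "('a::ring_1 \<Rightarrow> 'a \<Rightarrow> 'a) \<Rightarrow> ('a \<Rightarrow> int extended) \<Rightarrow> bool"
  where "gr_bracket_commutative br u \<longleftrightarrow>
    (\<forall>X\<in>gr_carrier u. \<forall>Y\<in>gr_carrier u. gr_op u br X Y = gr_zero u)"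

definition gr_homogeneous :: "('a::ab_group_add \<Rightarrow> int extended) \<Rightarrow> int \<Rightarrow> 'a \<Rightarrow> int \<Rightarrow> 'a set"
  where "gr_homogeneous u i x = (gr_zero u)(i := gr_coset u i x)"

lemma degree_map_minus:
  assumes "degree_map br u" shows "u (- x) = u x"
proof -
  have mul: "u (z * w) = u z + u w" for z w using assms by (auto simp: degree_map_def)
  have ninf: "u z \<noteq> \<infinity>" for z using assms by (auto simp: degree_map_def)
  have zero: "u z = -\<infinity> \<longleftrightarrow> z = 0" for z using assms by (auto simp: degree_map_def)
  have one: "u 1 = Fin 0"
    using mul[of 1 1] ninf[of 1] zero[of 1] by (cases "u 1") auto
  have "u (-1) = Fin 0"
    using mul[of "-1" "-1"] one ninf[of "-1"] zero[of "-1"] by (cases "u (-1)") auto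
  then have "u (-1 * x) = u x"
    using mul[of "-1" x] by (metis add.left_neutral zero_extended_def)
  then show ?thesis by simp
qed

lemma filt_add: "degree_map br u \<Longrightarrow> x \<in> filt u i \<Longrightarrow> y \<in> filt u i \<Longrightarrow> x + y \<in> filt u i"
  unfolding filt_def degree_map_def by (smt (verit) max_def mem_Collect_eq order_trans)

lemma filt_minus: "degree_map br u \<Longrightarrow> x \<in> filt u i \<Longrightarrow> y \<in> filt u i \<Longrightarrow> x - y \<in> filt u i"
  using filt_add[of br u x i "- y"] degree_map_minus[of br u y] by (simp add: filt_def)

lemma filt_zero: "degree_map br u \<Longrightarrow> 0 \<in> filt u i"
  by (metis (mono_tags, lifting) Minf_le degree_map_def filt_def mem_Collect_eq)

lemma gr_coset_eq_iff:
  assumes "degree_map br u"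
  shows "gr_coset u i x = gr_coset u i y \<longleftrightarrow> x - y \<in> filt u (i - 1)"
proof
  assume "gr_coset u i x = gr_coset u i y"
  moreover have "x \<in> gr_coset u i x"
    using filt_zero[OF assms] by (auto simp: gr_coset_def intro!: exI[of _ 0])
  ultimately show "x - y \<in> filt u (i - 1)" by (auto simp: gr_coset_def)
next
  assume d: "x - y \<in> filt u (i - 1)"
  have "x + p = y + ((x - y) + p)" "y + p = x + (p - (x - y))" for p by auto
  with d show "gr_coset u i x = gr_coset u i y"
    unfolding gr_coset_def using filt_add[OF assms d] filt_minus[OF assms _ d] by blast
qed

lemma gr_op_homogeneous:
  assumes u: "degree_map br u"
    and f: "\<And>x x' y. f (x - x') y = f x y - f x' y" "\<And>x y y'. f x (y - y') = f x y - f x y'"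
    and uf: "\<And>x y. u (f x y) \<le> u x + u y"
    and x: "x \<in> filt u i" and y: "y \<in> filt u j"
  shows "gr_op u f (gr_homogeneous u i x) (gr_homogeneous u j y) = gr_homogeneous u (i + j) (f x y)"
proof
  fix n
  have ff: "f a b \<in> filt u (k + l)" if "a \<in> filt u k" "b \<in> filt u l" for a b k l
  proof -
    have "u a + u b \<le> Fin (k + l)"
      using that by (cases "u a"; cases "u b") (auto simp: filt_def)
    then show ?thesis using uf[of a b] by (auto simp: filt_def intro: order_trans)
  qed
  have zero: "gr_zero u k = gr_coset u k 0" for k by (auto simp: gr_zero_def gr_coset_def)
  let ?X = "gr_homogeneous u i x" and ?Y = "gr_homogeneous u j y"
  let ?S = "{k. ?X k \<noteq> gr_zero u k \<and> ?Y (n - k) \<noteq> gr_zero u (n - k)}"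
  have S: "?S \<subseteq> {i}" "?S \<noteq> {} \<Longrightarrow> n = i + j"
    by (auto simp: gr_homogeneous_def split: if_splits)
  show "gr_op u f ?X ?Y n = gr_homogeneous u (i + j) (f x y) n"
  proof (cases "?S = {}")
    case True
    have "f x y \<in> filt u (i + j - 1)" if "n = i + j"
    proof -
      have "x \<in> filt u (i - 1) \<or> y \<in> filt u (j - 1)"
      proof -
        have "?X i = gr_zero u i \<or> ?Y (n - i) = gr_zero u (n - i)" using True by blast
        then have "gr_coset u i x = gr_coset u i 0 \<or> gr_coset u j y = gr_coset u j 0"
          using that by (simp add: gr_homogeneous_def zero)
        then show ?thesis
          using gr_coset_eq_iff[OF u, of i x 0] gr_coset_eq_iff[OF u, of j y 0] by simp
      qed
      then show ?thesis
        using ff[of x "i - 1" y j] ff[of x i y "j - 1"] x y by (auto simp: algebra_simps)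
    qed
    then have "gr_homogeneous u (i + j) (f x y) n = gr_coset u n 0"
      using gr_coset_eq_iff[OF u, of "i + j" "f x y" 0] by (auto simp: gr_homogeneous_def zero)
    then show ?thesis unfolding gr_op_def True by simp
  next
    case False
    then have S': "?S = {i}" and n: "n = i + j" using S by auto
    define x' y' where "x' = (SOME a. a \<in> ?X i)" and "y' = (SOME a. a \<in> ?Y (n - i))"
    have mem: "a \<in> gr_coset u k a" for a k
      using filt_zero[OF u] by (auto simp: gr_coset_def intro!: exI[of _ 0])
    have "x' \<in> gr_coset u i x" "y' \<in> gr_coset u j y"
      unfolding x'_def y'_def using n by (simp_all add: gr_homogeneous_def some_in_eq) (use mem in blast)+
    then have d: "x' - x \<in> filt u (i - 1)" "y' - y \<in> filt u (j - 1)" by (auto simp: gr_coset_def)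
    have "filt u (i - 1) \<subseteq> filt u i" by (auto simp: filt_def elim: order_trans)
    then have x': "x' \<in> filt u i" using filt_add[OF u, of "x' - x" i x] d x by auto
    have "f x' y' - f x y = f x' (y' - y) + f (x' - x) y" by (simp add: f)
    moreover have "f x' (y' - y) \<in> filt u (i + j - 1)" "f (x' - x) y \<in> filt u (i + j - 1)"
      using ff[OF x' d(2)] ff[OF d(1) y] by (auto simp: algebra_simps)
    ultimately have "f x' y' - f x y \<in> filt u (n - 1)" using filt_add[OF u] n by simp
    then have "gr_coset u n (f x' y') = gr_coset u n (f x y)" by (simp add: gr_coset_eq_iff[OF u])
    then show ?thesis unfolding gr_op_def S' using n
      by (simp add: x'_def y'_def gr_homogeneous_def)
  qed
qed


section \<open>Tensor products\<close>

text \<open>The free vector space on \<open>'a \<times> 'b\<close> is \<^typ>\<open>('a \<times> 'b) \<Rightarrow>\<^sub>0 'k\<close>.\<close>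

definition free_scale :: "'k::field \<Rightarrow> ('x \<Rightarrow>\<^sub>0 'k) \<Rightarrow> ('x \<Rightarrow>\<^sub>0 'k)"
  where "free_scale c = Poly_Mapping.map ((*) c)"

abbreviation free_pair :: "'a \<Rightarrow> 'b \<Rightarrow> ('a \<times> 'b) \<Rightarrow>\<^sub>0 'k::field"
  where "free_pair a b \<equiv> Poly_Mapping.single (a, b) 1"

definition tensor_relations ::
  "('k::field \<Rightarrow> 'a::ab_group_add \<Rightarrow> 'a) \<Rightarrow> ('k \<Rightarrow> 'b::ab_group_add \<Rightarrow> 'b) \<Rightarrow>
   (('a \<times> 'b) \<Rightarrow>\<^sub>0 'k) set"
  where "tensor_relations s1 s2 =
    {free_pair (a + a') b - free_pair a b - free_pair a' b | a a' b. True} \<union>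
    {free_pair a (b + b') - free_pair a b - free_pair a b' | a b b'. True} \<union>
    {free_pair (s1 c a) b - free_scale c (free_pair a b) | a b c. True} \<union>
    {free_pair a (s2 c b) - free_scale c (free_pair a b) | a b c. True}"

text \<open>The linear extension of a map on pairs to the free vector space.\<close>

definition free_extend ::
  "('k::field \<Rightarrow> 't::ab_group_add \<Rightarrow> 't) \<Rightarrow> ('a \<Rightarrow> 'b \<Rightarrow> 't) \<Rightarrow> (('a \<times> 'b) \<Rightarrow>\<^sub>0 'k) \<Rightarrow> 't"
  where "free_extend s t p =
    (\<Sum>x\<in>Poly_Mapping.keys p. s (Poly_Mapping.lookup p x) (t (fst x) (snd x)))"

text \<open>The tensor product is the quotient of the free vector space on pairs by the span of the
  bilinearity relations. As the scalar multiplications are not part of the types, this quotient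
  cannot be a type constructor; instead, \<open>'t\<close> with the map \<open>t\<close> is a tensor product
  if \<open>t\<close> identifies \<open>'t\<close> with that quotient. The universal property is proved below.\<close>

definition tensor_product ::
  "('k::field \<Rightarrow> 'a::ab_group_add \<Rightarrow> 'a) \<Rightarrow> ('k \<Rightarrow> 'b::ab_group_add \<Rightarrow> 'b) \<Rightarrow>
   ('k \<Rightarrow> 't::ab_group_add \<Rightarrow> 't) \<Rightarrow> ('a \<Rightarrow> 'b \<Rightarrow> 't) \<Rightarrow> bool"
  where "tensor_product s1 s2 s t \<longleftrightarrow> vector_space s \<and> surj (free_extend s t) \<and>
    {p. free_extend s t p = 0} = module.span free_scale (tensor_relations s1 s2)"

lemma lookup_free_scale: "Poly_Mapping.lookup (free_scale c p) x = c * Poly_Mapping.lookup p x"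
  by (simp add: free_scale_def map.rep_eq when_def)

lemma vector_space_free_scale: "vector_space free_scale"
  by unfold_locales (auto intro!: poly_mapping_eqI simp: lookup_free_scale lookup_add algebra_simps)

lemma free_extend_superset:
  assumes "vector_space s" "finite A" "Poly_Mapping.keys p \<subseteq> A"
  shows "free_extend s t p = (\<Sum>x\<in>A. s (Poly_Mapping.lookup p x) (t (fst x) (snd x)))"
proof -
  interpret vector_space s by fact
  show ?thesis unfolding free_extend_def
    by (rule sum.mono_neutral_left) (use assms in \<open>auto simp: in_keys_iff\<close>)
qed

lemma linear_free_extend:
  fixes s :: "'k::field \<Rightarrow> 't::ab_group_add \<Rightarrow> 't" and t :: "'a \<Rightarrow> 'b \<Rightarrow> 't"
  assumes s: "vector_space s"
  shows "Vector_Spaces.linear free_scale s (free_extend s t)"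
proof -
  interpret S: vector_space s by fact
  interpret F: vector_space "free_scale :: 'k \<Rightarrow> (('a \<times> 'b) \<Rightarrow>\<^sub>0 'k) \<Rightarrow> _" by (rule vector_space_free_scale)
  show ?thesis
  proof (rule Vector_Spaces.linear.intro)
    show "module_hom free_scale s (free_extend s t)"
    proof unfold_locales
      fix p q :: "('a \<times> 'b) \<Rightarrow>\<^sub>0 'k"
      let ?A = "Poly_Mapping.keys p \<union> Poly_Mapping.keys q"
      have "Poly_Mapping.keys (p + q) \<subseteq> ?A" by (rule keys_add)
      then show "free_extend s t (p + q) = free_extend s t p + free_extend s t q"
        using free_extend_superset[OF s, of ?A "p + q" t] free_extend_superset[OF s, of ?A p t]
          free_extend_superset[OF s, of ?A q t]
        by (simp add: lookup_add S.scale_left_distrib sum.distrib)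
    next
      fix c and p :: "('a \<times> 'b) \<Rightarrow>\<^sub>0 'k"
      have "Poly_Mapping.keys (free_scale c p) \<subseteq> Poly_Mapping.keys p"
        by (auto simp: in_keys_iff lookup_free_scale)
      then show "free_extend s t (free_scale c p) = s c (free_extend s t p)"
        using free_extend_superset[OF s, of "Poly_Mapping.keys p" "free_scale c p" t]
        by (simp add: free_extend_def lookup_free_scale S.scale_sum_right)
    qed
  qed (rule vector_space_free_scale s)+
qed

lemma free_extend_pair: "vector_space s \<Longrightarrow> free_extend s t (free_pair a b) = t a b"
  by (simp add: free_extend_def vector_space.vector_space_assms)

lemma tensor_product_bilinear:
  assumes s1: "vector_space s1" and s2: "vector_space s2" and T: "tensor_product s1 s2 s t"
  shows "bilinear_map s1 s2 s t"
proof -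
  have s: "vector_space s" using T by (simp add: tensor_product_def)
  interpret L: Vector_Spaces.linear free_scale s "free_extend s t" by (rule linear_free_extend[OF s])
  have 0: "free_extend s t r = 0" if "r \<in> tensor_relations s1 s2" for r
    using T L.vs1.span_base[OF that] by (auto simp: tensor_product_def)
  note simps = L.diff L.add L.scale free_extend_pair[OF s]
  have "t (a + a') b = t a b + t a' b" for a a' b
  proof -
    have "free_pair (a + a') b - free_pair a b - free_pair a' b \<in> tensor_relations s1 s2"
      unfolding tensor_relations_def by blast
    from 0[OF this] show ?thesis by (simp add: simps) (simp add: algebra_simps)
  qed
  moreover have "t a (b + b') = t a b + t a b'" for a b b'
  proof -
    have "free_pair a (b + b') - free_pair a b - free_pair a b' \<in> tensor_relations s1 s2"
      unfolding tensor_relations_def by blast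
    from 0[OF this] show ?thesis by (simp add: simps) (simp add: algebra_simps)
  qed
  moreover have "t (s1 c a) b = s c (t a b)" for a b c
  proof -
    have "free_pair (s1 c a) b - free_scale c (free_pair a b) \<in> tensor_relations s1 s2"
      unfolding tensor_relations_def by blast
    from 0[OF this] show ?thesis by (simp add: simps)
  qed
  moreover have "t a (s2 c b) = s c (t a b)" for a b c
  proof -
    have "free_pair a (s2 c b) - free_scale c (free_pair a b) \<in> tensor_relations s1 s2"
      unfolding tensor_relations_def by blast
    from 0[OF this] show ?thesis by (simp add: simps)
  qed
  ultimately show ?thesis using s1 s2 s
    by (simp add: bilinear_map_def Vector_Spaces.linear_iff)
qed

lemma tensor_product_universal:
  assumes T: "tensor_product s1 s2 s t" and f: "bilinear_map s1 s2 s3 f"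
  shows "\<exists>!g. Vector_Spaces.linear s s3 g \<and> (\<forall>a b. g (t a b) = f a b)"
proof -
  have s: "vector_space s" using T by (simp add: tensor_product_def)
  have s3: "vector_space s3" using f by (auto simp: bilinear_map_def Vector_Spaces.linear_iff)
  interpret L: Vector_Spaces.linear free_scale s "free_extend s t" by (rule linear_free_extend[OF s])
  interpret M: Vector_Spaces.linear free_scale s3 "free_extend s3 f" by (rule linear_free_extend[OF s3])
  have "free_extend s3 f r = 0" if "r \<in> tensor_relations s1 s2" for r
    using that f
    by (auto simp: tensor_relations_def M.diff M.scale free_extend_pair[OF s3] bilinear_map_def
        Vector_Spaces.linear_iff)
  then have "free_extend s3 f p = 0" if "p \<in> module.span free_scale (tensor_relations s1 s2)" for p
    using M.eq_0_on_span[OF _ that] by blast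
  then have ker: "free_extend s3 f p = 0" if "free_extend s t p = 0" for p
    using that T by (auto simp: tensor_product_def)
  define h where "h x = (SOME p. free_extend s t p = x)" for x
  have h: "free_extend s t (h x) = x" for x
    unfolding h_def by (rule someI_ex) (use T in \<open>auto simp: tensor_product_def surj_def, metis\<close>)
  define g where "g x = free_extend s3 f (h x)" for x
  have g: "g (free_extend s t p) = free_extend s3 f p" for p
    using ker[of "h (free_extend s t p) - p"] by (simp add: g_def L.diff M.diff h)
  have lin: "Vector_Spaces.linear s s3 g"
    unfolding Vector_Spaces.linear_iff
  proof (intro conjI allI s s3)
    show "g (x + y) = g x + g y" for x y
      using g[of "h x + h y"] by (simp add: L.add M.add h) (simp add: g_def)
    show "g (s c x) = s3 c (g x)" for c x
      using g[of "free_scale c (h x)"] by (simp add: L.scale M.scale h) (simp add: g_def)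
  qed
  show ?thesis
  proof (rule ex1I[of _ g])
    show "Vector_Spaces.linear s s3 g \<and> (\<forall>a b. g (t a b) = f a b)"
      using lin g[of "free_pair a b" for a b] by (simp add: free_extend_pair s s3)
  next
    fix g' assume g': "Vector_Spaces.linear s s3 g' \<and> (\<forall>a b. g' (t a b) = f a b)"
    then interpret G: Vector_Spaces.linear s s3 g' by simp
    have "g' (free_extend s t p) = free_extend s3 f p" for p
      unfolding free_extend_def using g' by (simp add: G.sum G.scale)
    then show "g' = g" using h g by (metis ext)
  qed
qed

text \<open>Both clauses determine the bracket, because it is bilinear and the
  \<open>t a b\<close> span \<open>'t\<close>.\<close>

definition poisson_tensor_product ::
  "('k::field \<Rightarrow> 'a::ring_1 \<Rightarrow> 'a) \<Rightarrow> ('a \<Rightarrow> 'a \<Rightarrow> 'a) \<Rightarrow>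
   ('k \<Rightarrow> 'b::ring_1 \<Rightarrow> 'b) \<Rightarrow> ('b \<Rightarrow> 'b \<Rightarrow> 'b) \<Rightarrow>
   ('k \<Rightarrow> 't::ring_1 \<Rightarrow> 't) \<Rightarrow> ('t \<Rightarrow> 't \<Rightarrow> 't) \<Rightarrow> ('a \<Rightarrow> 'b \<Rightarrow> 't) \<Rightarrow> bool"
  where "poisson_tensor_product s1 br1 s2 br2 s br t \<longleftrightarrow>
    tensor_product s1 s2 s t \<and>
    bilinear_map s s s (*) \<and> t 1 1 = 1 \<and>
    (\<forall>a1 a2 b1 b2. t a1 a2 * t b1 b2 = t (a1 * b1) (a2 * b2)) \<and>
    bilinear_map s s s br \<and>
    (poisson_class1 s1 br1 \<and> poisson_class1 s2 br2 \<longrightarrow>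
      (\<forall>a1 a2 b1 b2. br (t a1 a2) (t b1 b2) = t (br1 a1 b1) (a2 * b2) + t (b1 * a1) (br2 a2 b2))) \<and>
    (poisson_class2 s1 br1 \<and> poisson_class2 s2 br2 \<longrightarrow> (\<forall>x y. br x y = x * y - y * x))"

text \<open>The tensor product of two subspaces, as a subspace of \<open>'t\<close>.\<close>

definition tensor_subspace ::
  "('k::field \<Rightarrow> 't::ab_group_add \<Rightarrow> 't) \<Rightarrow> ('a \<Rightarrow> 'b \<Rightarrow> 't) \<Rightarrow> 'a set \<Rightarrow> 'b set \<Rightarrow> 't set"
  where "tensor_subspace s t A B = module.span s {t a b | a b. a \<in> A \<and> b \<in> B}"


section \<open>Sets attached to an element\<close>

text \<open>\<open>p(g)(x)\<close> for a polynomial \<open>p\<close> and an endomorphism \<open>g\<close>.\<close>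

definition poly_endo_apply ::
  "('k::field \<Rightarrow> 'a::ab_group_add \<Rightarrow> 'a) \<Rightarrow> 'k poly \<Rightarrow> ('a \<Rightarrow> 'a) \<Rightarrow> 'a \<Rightarrow> 'a"
  where "poly_endo_apply s p g x = (\<Sum>i\<le>degree p. s (coeff p i) ((g ^^ i) x))"

text \<open>Below, \<open>br z\<close> is the map \<open>ad\<^sub>z\<close>.\<close>

definition Ev_set :: "('k::field \<Rightarrow> 'a::ab_group_add \<Rightarrow> 'a) \<Rightarrow> ('a \<Rightarrow> 'a \<Rightarrow> 'a) \<Rightarrow> 'a \<Rightarrow> 'k set"
  where "Ev_set s br z = {l. \<exists>x. x \<noteq> 0 \<and> br z x = s l x}"

definition F_set :: "('k::field \<Rightarrow> 'a::ab_group_add \<Rightarrow> 'a) \<Rightarrow> ('a \<Rightarrow> 'a \<Rightarrow> 'a) \<Rightarrow> 'a \<Rightarrow> 'a set"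
  where "F_set s br z = {x. finite_dim s (range (\<lambda>p. poly_endo_apply s p (br z) x))}"

definition N_set :: "('a::ab_group_add \<Rightarrow> 'a \<Rightarrow> 'a) \<Rightarrow> 'a \<Rightarrow> 'a set"
  where "N_set br z = {x. \<exists>m. (br z ^^ m) x = 0}"

definition C_set :: "('a::ab_group_add \<Rightarrow> 'a \<Rightarrow> 'a) \<Rightarrow> 'a \<Rightarrow> 'a set"
  where "C_set br z = {x. br z x = 0}"

text \<open>The sum of the eigenspaces, which is automatically direct.\<close>

definition D_set :: "('k::field \<Rightarrow> 'a::ab_group_add \<Rightarrow> 'a) \<Rightarrow> ('a \<Rightarrow> 'a \<Rightarrow> 'a) \<Rightarrow> 'a \<Rightarrow> 'a set"
  where "D_set s br z = module.span s (\<Union>l\<in>Ev_set s br z. {x. br z x = s l x})"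

end

theory Submission
  imports Defs
begin

text \<open>In both classes the adjoint map of \<open>\<Theta>\<close> is \<open>ad z1 \<otimes> L + R \<otimes> ad z2\<close>, where \<open>L\<close> is left
  multiplication by \<open>z2\<close> and \<open>R\<close> is right multiplication by \<open>z1\<close>. As \<open>z2\<close> is not a scalar, its
  degree \<open>d\<close> is positive: \<open>L\<close> raises the degree in the second factor by exactly \<open>d\<close>, whereas
  \<open>ad z2\<close> raises it by at most \<open>d - 1\<close> because the graded bracket vanishes. Hence if the orbit of
  \<open>x\<close> spans a finite dimensional space, some power of \<open>ad z1\<close> kills the leading coefficients of
  \<open>x\<close>; iterating, some power of \<open>ad z1 \<otimes> id\<close> kills \<open>x\<close>. By symmetry some power of
  \<open>id \<otimes> ad z2\<close> kills \<open>x\<close>, so \<open>F(\<Theta>) \<subseteq> N(z1) \<otimes> N(z2) \<subseteq> N(\<Theta>) \<subseteq> F(\<Theta>)\<close>. Eigenvectors lie in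
  \<open>F(\<Theta>)\<close>, so the only eigenvalue is \<open>0\<close>.\<close>

section \<open>Polynomials in an endomorphism\<close>

lemma poly_endo_apply_superset:
  assumes "vector_space s" "degree p \<le> n"
  shows "poly_endo_apply s p g x = (\<Sum>i\<le>n. s (coeff p i) ((g ^^ i) x))"
proof -
  interpret vector_space s by fact
  show ?thesis unfolding poly_endo_apply_def
    by (rule sum.mono_neutral_left) (use assms in \<open>auto simp: coeff_eq_0\<close>)
qed

lemma poly_endo_apply_add:
  assumes "vector_space s"
  shows "poly_endo_apply s (p + q) g x = poly_endo_apply s p g x + poly_endo_apply s q g x"
proof -
  interpret vector_space s by fact
  let ?n = "max (degree p) (degree q)"
  show ?thesis
    using poly_endo_apply_superset[OF assms, of p ?n g x] poly_endo_apply_superset[OF assms, of q ?n g x]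
      poly_endo_apply_superset[OF assms, of "p + q" ?n g x] degree_add_le_max[of p q]
    by (simp add: scale_left_distrib sum.distrib)
qed

lemma poly_endo_apply_smult:
  assumes "vector_space s"
  shows "poly_endo_apply s (smult c p) g x = s c (poly_endo_apply s p g x)"
proof -
  interpret vector_space s by fact
  show ?thesis
    using poly_endo_apply_superset[OF assms, of "smult c p" "degree p" g x] degree_smult_le[of c p]
    by (simp add: poly_endo_apply_def scale_sum_right)
qed

lemma poly_endo_apply_0: "vector_space s \<Longrightarrow> poly_endo_apply s 0 g x = 0"
  by (simp add: poly_endo_apply_def module.scale_zero_left module_iff_vector_space)

lemma poly_endo_apply_monom:
  assumes "vector_space s"
  shows "poly_endo_apply s (monom c n) g x = s c ((g ^^ n) x)"
proof -
  interpret vector_space s by fact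
  have "poly_endo_apply s (monom c n) g x = (\<Sum>i\<le>n. s (coeff (monom c n) i) ((g ^^ i) x))"
    by (rule poly_endo_apply_superset[OF assms degree_monom_le])
  also have "\<dots> = (\<Sum>i\<le>n. if i = n then s c ((g ^^ n) x) else 0)"
    by (rule sum.cong) auto
  finally show ?thesis by simp
qed

lemma poly_endo_apply_pCons:
  assumes "Vector_Spaces.linear s s g"
  shows "poly_endo_apply s (pCons c p) g x = s c x + g (poly_endo_apply s p g x)"
proof -
  interpret Vector_Spaces.linear s s g by fact
  have "poly_endo_apply s (pCons c p) g x
      = (\<Sum>i\<le>Suc (degree p). s (coeff (pCons c p) i) ((g ^^ i) x))"
    by (rule poly_endo_apply_superset[OF vs1.vector_space_axioms degree_pCons_le])
  then show ?thesis
    by (simp add: sum.atMost_Suc_shift poly_endo_apply_def sum scale del: sum.atMost_Suc)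
qed

text \<open>This turns membership in \<open>F_set\<close> into a condition on the orbit of
  \<open>x\<close>: evaluation is linear in the polynomial, and the monomials give the
  iterates.\<close>

lemma range_poly_endo_apply:
  assumes "vector_space s"
  shows "range (\<lambda>p. poly_endo_apply s p g x) = module.span s (range (\<lambda>n. (g ^^ n) x))"
proof -
  interpret vector_space s by fact
  show ?thesis
  proof
    show "range (\<lambda>p. poly_endo_apply s p g x) \<subseteq> span (range (\<lambda>n. (g ^^ n) x))"
    proof
      fix y assume "y \<in> range (\<lambda>p. poly_endo_apply s p g x)"
      then obtain p where "y = (\<Sum>i\<le>degree p. s (coeff p i) ((g ^^ i) x))"
        by (auto simp: poly_endo_apply_def)
      also have "\<dots> \<in> span (range (\<lambda>n. (g ^^ n) x))"
        by (intro span_sum span_scale span_base) auto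
      finally show "y \<in> span (range (\<lambda>n. (g ^^ n) x))" .
    qed
    have "subspace (range (\<lambda>p. poly_endo_apply s p g x))"
      by (rule subspaceI)
        (use poly_endo_apply_0[OF assms, of g x] in
          \<open>auto simp flip: poly_endo_apply_add[OF assms] poly_endo_apply_smult[OF assms]
            intro: range_eqI[OF sym]\<close>)
    moreover have "(g ^^ n) x \<in> range (\<lambda>p. poly_endo_apply s p g x)" for n
      using poly_endo_apply_monom[OF assms, of 1 n g x] by (metis rangeI scale_one)
    ultimately show "span (range (\<lambda>n. (g ^^ n) x)) \<subseteq> range (\<lambda>p. poly_endo_apply s p g x)"
      by (intro span_minimal) auto
  qed
qed

text \<open>Once a power of \<open>br z\<close> kills \<open>x\<close>, all later iterates vanish,
  so the orbit is a finite set.\<close>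

lemma N_set_subset_F_set:
  assumes "vector_space s" and L: "Vector_Spaces.linear s s (br z)"
  shows "N_set br z \<subseteq> F_set s br z"
proof
  interpret L: Vector_Spaces.linear s s "br z" by fact
  fix x assume "x \<in> N_set br z"
  then obtain m where m: "(br z ^^ m) x = 0" by (auto simp: N_set_def)
  have zero: "(br z ^^ k) 0 = 0" for k by (induction k) (auto simp: L.zero)
  have "(br z ^^ n) x \<in> insert 0 ((\<lambda>n. (br z ^^ n) x) ` {..<m})" for n
  proof (cases "n < m")
    case False
    then have "(br z ^^ n) x = (br z ^^ (n - m)) ((br z ^^ m) x)"
      by (metis comp_apply funpow_add le_add_diff_inverse2 not_le)
    then show ?thesis by (simp add: m zero)
  qed auto
  then have "range (\<lambda>n. (br z ^^ n) x) \<subseteq> insert 0 ((\<lambda>n. (br z ^^ n) x) ` {..<m})"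
    by (rule image_subsetI)
  then have "finite (range (\<lambda>n. (br z ^^ n) x))"
    by (rule finite_subset) simp
  then show "x \<in> F_set s br z"
    unfolding F_set_def finite_dim_def range_poly_endo_apply[OF assms(1)] by blast
qed

lemma linear_funpow:
  "Vector_Spaces.linear s s f \<Longrightarrow> Vector_Spaces.linear s s (f ^^ n)"
proof (induction n)
  case (Suc n)
  then show ?case
    using Vector_Spaces.linear_compose[of s s "f ^^ n" s f] by (simp add: comp_def)
qed (simp add: Vector_Spaces.linear_iff)


section \<open>Contractions of tensors\<close>

text \<open>The target types of a locale assumption are fixed, so the universal property is stated
  for two targets: \<open>'b\<close> gives the contractions and \<open>'t\<close> gives tensor
  products of linear maps.\<close>

locale tensor_space =
  v1: vector_space s1 + v2: vector_space s2 + v: vector_space s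
  for s1 :: "'k::field \<Rightarrow> 'a::ab_group_add \<Rightarrow> 'a"
    and s2 :: "'k \<Rightarrow> 'b::ab_group_add \<Rightarrow> 'b"
    and s :: "'k \<Rightarrow> 't::ab_group_add \<Rightarrow> 't" +
  fixes t :: "'a \<Rightarrow> 'b \<Rightarrow> 't"
  assumes bilinear: "bilinear_map s1 s2 s t"
    and generated: "tensor_subspace s t UNIV UNIV = UNIV"
    and universal_right: "bilinear_map s1 s2 s2 f \<Longrightarrow>
      \<exists>g. Vector_Spaces.linear s s2 g \<and> (\<forall>a b. g (t a b) = f a b)"
    and universal_self: "bilinear_map s1 s2 s f' \<Longrightarrow>
      \<exists>g'. Vector_Spaces.linear s s g' \<and> (\<forall>a b. g' (t a b) = f' a b)"
begin

sublocale left: Vector_Spaces.linear s1 s "\<lambda>a. t a b" for b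
  using bilinear by (simp add: bilinear_map_def)

sublocale right: Vector_Spaces.linear s2 s "t a" for a
  using bilinear by (simp add: bilinear_map_def)

text \<open>Scalars are absorbed into the first factor and zero is \<open>t 0 0\<close>, so sums of
  pure tensors exhaust the space.\<close>

lemma tensor_induct [case_names tensor add]:
  assumes "\<And>a b. P (t a b)" and "\<And>x y. P x \<Longrightarrow> P y \<Longrightarrow> P (x + y)"
  shows "P x"
proof -
  have "x \<in> v.span {t a b | a b. a \<in> UNIV \<and> b \<in> UNIV}"
    using generated by (auto simp: tensor_subspace_def)
  then show ?thesis
  proof (induction rule: v.span_induct_alt)
    case base
    show ?case using assms(1)[of 0 0] by (simp add: left.zero)
  next
    case (step c x y)
    then obtain a b where "x = t a b" by blast
    then have "s c x = t (s1 c a) b" by (simp add: left.scale)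
    then show ?case using assms step by metis
  qed
qed

lemma linear_eqI:
  assumes "Vector_Spaces.linear s s' g" "Vector_Spaces.linear s s' h" "\<And>a b. g (t a b) = h (t a b)"
  shows "g x = h x"
proof -
  interpret g: Vector_Spaces.linear s s' g by fact
  interpret h: Vector_Spaces.linear s s' h by fact
  show ?thesis by (induction x rule: tensor_induct) (auto simp: assms g.add h.add)
qed

section \<open>Contraction with linear functionals on the first factor\<close>

abbreviation functional :: "('a \<Rightarrow> 'k) \<Rightarrow> bool"
  where "functional \<phi> \<equiv> Vector_Spaces.linear s1 (*) \<phi>"

text \<open>This is \<phi> \<otimes> id, with K \<otimes> \<open>'b\<close> identified with
  \<open>'b\<close>.\<close>

definition contract :: "('a \<Rightarrow> 'k) \<Rightarrow> 't \<Rightarrow> 'b"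
  where "contract \<phi> = (SOME g. Vector_Spaces.linear s s2 g \<and> (\<forall>a b. g (t a b) = s2 (\<phi> a) b))"

lemma
  assumes "functional \<phi>"
  shows linear_contract: "Vector_Spaces.linear s s2 (contract \<phi>)"
    and contract_tensor: "contract \<phi> (t a b) = s2 (\<phi> a) b"
proof -
  have "bilinear_map s1 s2 s2 (\<lambda>a b. s2 (\<phi> a) b)"
    using assms v1.vector_space_axioms v2.vector_space_axioms
    by (simp add: bilinear_map_def Vector_Spaces.linear_iff v2.scale_left_distrib
        v2.scale_right_distrib mult.commute)
  from someI_ex[OF universal_right[OF this]]
  show "Vector_Spaces.linear s s2 (contract \<phi>)" "contract \<phi> (t a b) = s2 (\<phi> a) b"
    unfolding contract_def by auto
qed

text \<open>For a basis \<open>B\<close> of the first factor, \<open>x\<close> is a finite sum of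
  tensors of basis vectors with coefficients in the second factor, and these coefficients are the
  contractions with the coordinate functionals.\<close>

lemma contract_separates:
  assumes "\<And>\<phi>. functional \<phi> \<Longrightarrow> contract \<phi> x = 0"
  shows "x = 0"
proof -
  define B where "B = v1.extend_basis {}"
  have B: "v1.independent B" "v1.span B = UNIV"
    unfolding B_def using v1.independent_extend_basis v1.span_extend_basis v1.independent_empty
    by blast+
  define co where "co b a = v1.representation B a b" for b a
  have co: "functional (co b)" for b
    unfolding Vector_Spaces.linear_iff co_def
    by (auto simp: v1.representation_add v1.representation_scale B v1.vector_space_axioms
        vector_space_def algebra_simps)
  interpret c: Vector_Spaces.linear s s2 "contract (co b)" for b by (rule linear_contract[OF co])
  \<comment> \<open>Recording that the coefficients vanish off \<open>F\<close> allows two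
    expansions to be merged over the union of their index sets.\<close>
  have "\<exists>F. finite F \<and> (\<forall>b. b \<notin> F \<longrightarrow> contract (co b) x = 0) \<and> x = (\<Sum>b\<in>F. t b (contract (co b) x))"
  proof (induction x rule: tensor_induct)
    case (tensor a y)
    let ?F = "{b. co b a \<noteq> 0}"
    have "finite ?F" unfolding co_def by (rule v1.finite_representation)
    moreover have "(\<Sum>b\<in>?F. s1 (co b a) b) = a"
      unfolding co_def using v1.sum_nonzero_representation_eq[OF B(1)] B(2) by simp
    then have "t a y = t (\<Sum>b\<in>?F. s1 (co b a) b) y" by simp
    then have "t a y = (\<Sum>b\<in>?F. t b (s2 (co b a) y))"
      by (simp add: left.sum left.scale right.scale)
    moreover have "(\<Sum>b\<in>?F. t b (s2 (co b a) y)) = (\<Sum>b\<in>?F. t b (contract (co b) (t a y)))"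
      by (simp add: contract_tensor[OF co])
    moreover have "\<forall>b. b \<notin> ?F \<longrightarrow> contract (co b) (t a y) = 0"
      by (simp add: contract_tensor[OF co])
    ultimately show ?case by (intro exI[of _ ?F]) simp
  next
    case (add x y)
    then obtain F G where
      F: "finite F" "\<forall>b. b \<notin> F \<longrightarrow> contract (co b) x = 0" "x = (\<Sum>b\<in>F. t b (contract (co b) x))" and
      G: "finite G" "\<forall>b. b \<notin> G \<longrightarrow> contract (co b) y = 0" "y = (\<Sum>b\<in>G. t b (contract (co b) y))"
      by blast
    have "(\<Sum>b\<in>F. t b (contract (co b) x)) = (\<Sum>b\<in>F \<union> G. t b (contract (co b) x))"
      by (rule sum.mono_neutral_left) (use F G in \<open>auto simp: right.zero\<close>)
    moreover have "(\<Sum>b\<in>G. t b (contract (co b) y)) = (\<Sum>b\<in>F \<union> G. t b (contract (co b) y))"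
      by (rule sum.mono_neutral_left) (use F G in \<open>auto simp: right.zero\<close>)
    ultimately have "x + y = (\<Sum>b\<in>F \<union> G. t b (contract (co b) (x + y)))"
      using F(3) G(3) by (simp add: c.add right.add sum.distrib)
    moreover have "\<forall>b. b \<notin> F \<union> G \<longrightarrow> contract (co b) (x + y) = 0"
      using F G by (simp add: c.add)
    ultimately show ?case using F(1) G(1) by (intro exI[of _ "F \<union> G"]) blast
  qed
  then show ?thesis using assms[OF co] by (auto simp: right.zero)
qed

section \<open>Tensor products of linear maps and their kernels\<close>

lemma tensor_map_exists:
  assumes "Vector_Spaces.linear s1 s1 f" "Vector_Spaces.linear s2 s2 g"
  shows "\<exists>h. Vector_Spaces.linear s s h \<and> (\<forall>a b. h (t a b) = t (f a) (g b))"
proof -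
  interpret f: Vector_Spaces.linear s1 s1 f by fact
  interpret g: Vector_Spaces.linear s2 s2 g by fact
  show ?thesis
    by (rule universal_self)
      (auto simp: bilinear_map_def Vector_Spaces.linear_iff f.add f.scale g.add g.scale
        left.add left.scale right.add right.scale v1.vector_space_axioms v2.vector_space_axioms
        v.vector_space_axioms)
qed

text \<open>A generalised inverse \<open>f'\<close> of \<open>f\<close> (that is, \<open>f \<circ> f' \<circ> f = f\<close>) makes
  \<open>id - f' \<circ> f\<close> a projection onto the kernel of \<open>f\<close>, so the tensor product of two such
  projections fixes \<open>x\<close>.\<close>

lemma tensor_kernels:
  assumes f: "Vector_Spaces.linear s1 s1 f" and g: "Vector_Spaces.linear s2 s2 g"
    and h1: "Vector_Spaces.linear s s h1" "\<And>a b. h1 (t a b) = t (f a) b" "h1 x = 0"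
    and h2: "Vector_Spaces.linear s s h2" "\<And>a b. h2 (t a b) = t a (g b)" "h2 x = 0"
  shows "x \<in> tensor_subspace s t {a. f a = 0} {b. g b = 0}"
proof -
  interpret f: Vector_Spaces.linear s1 s1 f by fact
  interpret g: Vector_Spaces.linear s2 s2 g by fact
  interpret h1: Vector_Spaces.linear s s h1 by fact
  interpret h2: Vector_Spaces.linear s s h2 by fact
  interpret p1: vector_space_pair s1 s1 ..
  interpret p2: vector_space_pair s2 s2 ..
  obtain f' where f': "Vector_Spaces.linear s1 s1 f'" "\<And>a. f (f' (f a)) = f a"
    using p1.linear_exists_right_inverse_on[OF f v1.subspace_UNIV] by auto
  obtain g' where g': "Vector_Spaces.linear s2 s2 g'" "\<And>b. g (g' (g b)) = g b"
    using p2.linear_exists_right_inverse_on[OF g v2.subspace_UNIV] by auto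
  obtain k1 where k1: "Vector_Spaces.linear s s k1" "\<And>a b. k1 (t a b) = t (f' a) b"
    using tensor_map_exists[OF f'(1) v2.linear_id] by (auto simp: id_def)
  obtain k2 where k2: "Vector_Spaces.linear s s k2" "\<And>a b. k2 (t a b) = t a (g' b)"
    using tensor_map_exists[OF v1.linear_id g'(1)] by (auto simp: id_def)
  interpret k1: Vector_Spaces.linear s s k1 by fact
  interpret k2: Vector_Spaces.linear s s k2 by fact
  let ?S = "tensor_subspace s t {a. f a = 0} {b. g b = 0}"
  \<comment> \<open>This is (id - f' \<circ> f) \<otimes> (id - g' \<circ> g), written through the
    lifted maps so that it can be evaluated at \<open>x\<close>, where \<open>h1\<close> and
    \<open>h2\<close> vanish.\<close>
  define q where "q y = (y - k2 (h2 y)) - k1 (h1 (y - k2 (h2 y)))" for y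
  have "q y \<in> ?S" for y
  proof (induction y rule: tensor_induct)
    case (tensor a b)
    have "q (t a b) = t (a - f' (f a)) (b - g' (g b))"
      by (simp add: q_def h1 h2 k1 k2 left.diff right.diff h1.diff k1.diff)
    moreover have "f (a - f' (f a)) = 0" "g (b - g' (g b)) = 0"
      by (simp_all add: f.diff g.diff f' g')
    ultimately show ?case
      by (auto simp: tensor_subspace_def intro!: v.span_base)
  next
    case (add y z)
    have "q (y + z) = q y + q z"
      by (simp add: q_def h1.add h2.add k1.add k2.add h1.diff k1.diff)
    then show ?case using add by (simp add: tensor_subspace_def v.span_add)
  qed
  moreover have "q x = x" by (simp add: q_def h1(3) h2(3) k1.zero k2.zero)
  ultimately show ?thesis by metis
qed

section \<open>Local finiteness forces nilpotency on the first factor\<close>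

text \<open>The contraction \<open>\<phi> \<otimes> id\<close> sends \<open>L\<^sup>n x\<close> to \<open>M\<^sup>n\<close> of the contraction
  of \<open>x\<close> by \<open>\<phi> \<circ> A\<^sup>n\<close>, up to terms of lower degree. The left side has bounded degree while
  \<open>M\<^sup>n\<close> raises degrees by \<open>n d\<close>, so the contractions of \<open>(A\<^sup>n \<otimes> id) x\<close> have
  lower degree than those of \<open>x\<close>.\<close>

lemma locally_finite_imp_left_nilpotent:
  fixes G :: "int \<Rightarrow> 'b set" and d :: int
  assumes sub: "\<And>k. v2.subspace (G k)" and mono: "\<And>k l. k \<le> l \<Longrightarrow> G k \<subseteq> G l"
    and ex: "\<And>y. \<exists>k. y \<in> G k" and neg: "\<And>k. k < 0 \<Longrightarrow> G k = {0}"
    and A: "Vector_Spaces.linear s1 s1 A" and B: "Vector_Spaces.linear s1 s1 B"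
    and AB: "\<And>a. A (B a) = B (A a)"
    and M: "Vector_Spaces.linear s2 s2 M" and D: "Vector_Spaces.linear s2 s2 D"
    and MG: "\<And>y k. M y \<in> G (k + d) \<longleftrightarrow> y \<in> G k"
    and DG: "\<And>y k. y \<in> G k \<Longrightarrow> D y \<in> G (k + d - 1)" and d: "d \<ge> 1"
    and L: "Vector_Spaces.linear s s L" "\<And>a b. L (t a b) = t (A a) (M b) + t (B a) (D b)"
    and fin: "finite_dim s (range (\<lambda>p. poly_endo_apply s p L x))"
  shows "\<exists>m h. Vector_Spaces.linear s s h \<and> (\<forall>a b. h (t a b) = t ((A ^^ m) a) b) \<and> h x = 0"
proof -
  interpret L: Vector_Spaces.linear s s L by fact
  interpret M: Vector_Spaces.linear s2 s2 M by fact
  interpret D: Vector_Spaces.linear s2 s2 D by fact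
  have fc: "functional (\<lambda>a. \<phi> (f a))" if "functional \<phi>" "Vector_Spaces.linear s1 s1 f" for \<phi> f
    using that by (simp add: Vector_Spaces.linear_iff)
  \<comment> \<open>Contraction moves the operators on the first factor into the functional.\<close>
  have step: "contract \<phi> (L y) = M (contract (\<lambda>a. \<phi> (A a)) y) + D (contract (\<lambda>a. \<phi> (B a)) y)"
    if \<phi>: "functional \<phi>" for \<phi> y
  proof -
    interpret c: Vector_Spaces.linear s s2 "contract \<phi>" by (rule linear_contract[OF \<phi>])
    interpret cA: Vector_Spaces.linear s s2 "contract (\<lambda>a. \<phi> (A a))"
      by (rule linear_contract[OF fc[OF \<phi> A]])
    interpret cB: Vector_Spaces.linear s s2 "contract (\<lambda>a. \<phi> (B a))"
      by (rule linear_contract[OF fc[OF \<phi> B]])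
    show ?thesis
      by (induction y rule: tensor_induct)
        (simp_all add: L(2) L.add c.add cA.add cB.add M.add D.add M.scale D.scale contract_tensor
          contract_tensor[OF fc] \<phi> A B algebra_simps)
  qed
  \<comment> \<open>The filtration \<open>G\<close> is transported to tensors; the result is again
    increasing and exhaustive.\<close>
  define bd where "bd N = {y. \<forall>\<phi>. functional \<phi> \<longrightarrow> contract \<phi> y \<in> G N}" for N
  have bd_sub: "v.subspace (bd N)" for N
    unfolding v.subspace_def bd_def
  proof (intro conjI allI impI ballI CollectI)
    fix \<phi> assume "functional \<phi>"
    then interpret c: Vector_Spaces.linear s s2 "contract \<phi>" by (rule linear_contract)
    show "contract \<phi> 0 \<in> G N" using sub by (simp add: c.zero v2.subspace_0)
  next
    fix \<phi> y z assume *: "functional \<phi>" and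
      yz: "y \<in> {y. \<forall>\<phi>. functional \<phi> \<longrightarrow> contract \<phi> y \<in> G N}"
      "z \<in> {y. \<forall>\<phi>. functional \<phi> \<longrightarrow> contract \<phi> y \<in> G N}"
    from * interpret c: Vector_Spaces.linear s s2 "contract \<phi>" by (rule linear_contract)
    show "contract \<phi> (y + z) \<in> G N" using sub yz * by (simp add: c.add v2.subspace_add)
  next
    fix \<phi> y r assume *: "functional \<phi>" and
      yz: "y \<in> {y. \<forall>\<phi>. functional \<phi> \<longrightarrow> contract \<phi> y \<in> G N}"
    from * interpret c: Vector_Spaces.linear s s2 "contract \<phi>" by (rule linear_contract)
    show "contract \<phi> (s r y) \<in> G N" using sub yz * by (simp add: c.scale v2.subspace_scale)
  qed
  have bd_mono: "bd k \<subseteq> bd l" if "k \<le> l" for k l using mono[OF that] by (auto simp: bd_def)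
  have bd_ex: "\<exists>N. y \<in> bd N" for y
  proof (induction y rule: tensor_induct)
    case (tensor a b)
    obtain k where "b \<in> G k" using ex by blast
    then have "t a b \<in> bd k"
      using sub by (auto simp: bd_def contract_tensor v2.subspace_scale)
    then show ?case ..
  next
    case (add y z)
    then obtain k l where "y \<in> bd k" "z \<in> bd l" by blast
    then have "y \<in> bd (max k l)" "z \<in> bd (max k l)"
      using bd_mono[of k "max k l"] bd_mono[of l "max k l"] by auto
    then show ?case using v.subspace_add[OF bd_sub] by blast
  qed
  \<comment> \<open>A finite spanning set of the orbit lies in a single \<open>bd N\<close>, so one
    bound serves all iterates.\<close>
  obtain N where N: "(L ^^ n) x \<in> bd N" for n
  proof -
    obtain S where S: "finite S" "v.span S = range (\<lambda>p. poly_endo_apply s p L x)"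
      using fin by (auto simp: finite_dim_def)
    have "\<exists>N. S \<subseteq> bd N"
      using S(1)
    proof induction
      case (insert y S)
      then obtain k l where "S \<subseteq> bd k" "y \<in> bd l" using bd_ex by blast
      then have "insert y S \<subseteq> bd (max k l)"
        using bd_mono[of k "max k l"] bd_mono[of l "max k l"] by auto
      then show ?case ..
    qed auto
    then obtain N where "v.span S \<subseteq> bd N" using v.span_minimal[OF _ bd_sub] by blast
    moreover have "(L ^^ n) x \<in> v.span S" for n
      unfolding S(2) range_poly_endo_apply[OF v.vector_space_axioms] by (auto intro: v.span_base)
    ultimately show ?thesis using that by blast
  qed
  have ABm: "(A ^^ m) (B a) = B ((A ^^ m) a)" for m a by (induction m) (auto simp: AB)
  \<comment> \<open>Each step lowers the degree bound by one at the price of a larger exponent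
    \<open>m\<close>.\<close>
  have desc: "\<exists>m. \<forall>\<phi>. functional \<phi> \<longrightarrow> contract (\<lambda>a. \<phi> ((A ^^ m) a)) x \<in> G (N - int k)" for k
  proof (induction k)
    case 0
    show ?case using N[of 0] by (intro exI[of _ 0]) (auto simp: bd_def)
  next
    case (Suc k)
    define e where "e = N - int k"
    from Suc obtain m where
      m: "contract (\<lambda>a. \<phi> ((A ^^ m) a)) x \<in> G e" if "functional \<phi>" for \<phi>
      unfolding e_def by blast
    have MnG: "(M ^^ n) y \<in> G (k + int n * d) \<longleftrightarrow> y \<in> G k" for n y k
      by (induction n) (use MG[of _ "k + int n * d" for n] in \<open>simp_all add: algebra_simps\<close>)
    \<comment> \<open>The leading term comes from choosing \<open>A\<close> and \<open>M\<close>
      every time; each choice of \<open>B\<close> and \<open>D\<close> loses a degree. The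
      functional is quantified inside the induction because the step replaces \<phi> by \<phi>
      \<circ> A and \<phi> \<circ> B.\<close>
    have lead: "\<forall>\<phi>. functional \<phi> \<longrightarrow> contract (\<lambda>a. \<phi> ((A ^^ m) a)) ((L ^^ n) x)
        - (M ^^ n) (contract (\<lambda>a. \<phi> ((A ^^ (m + n)) a)) x) \<in> G (e + int n * d - 1)" for n
    proof (induction n)
      case 0
      show ?case using sub by (simp add: v2.subspace_0)
    next
      case (Suc n)
      show ?case
      proof (intro allI impI)
        fix \<phi> assume \<phi>: "functional \<phi>"
        define \<alpha> \<beta> where "\<alpha> = (\<lambda>a. \<phi> (A a))" and "\<beta> = (\<lambda>a. \<phi> (B a))"
        have \<alpha>\<beta>: "functional \<alpha>" "functional \<beta>" using fc[OF \<phi>] A B by (auto simp: \<alpha>_def \<beta>_def)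
        let ?y = "(L ^^ n) x"
        \<comment> \<open>Moving \<open>A ^^ m\<close> past \<open>B\<close> gives both new
          functionals the shape required by the induction hypothesis.\<close>
        have eq: "contract (\<lambda>a. \<phi> ((A ^^ m) a)) ((L ^^ Suc n) x) =
            M (contract (\<lambda>a. \<alpha> ((A ^^ m) a)) ?y) + D (contract (\<lambda>a. \<beta> ((A ^^ m) a)) ?y)"
          using step[OF fc[OF \<phi> linear_funpow[OF A]], of m ?y]
          by (simp add: \<alpha>_def \<beta>_def ABm funpow_swap1)
        define r where "r = contract (\<lambda>a. \<alpha> ((A ^^ m) a)) ?y
          - (M ^^ n) (contract (\<lambda>a. \<alpha> ((A ^^ (m + n)) a)) x)"
        have "r \<in> G (e + int n * d - 1)" unfolding r_def using Suc \<alpha>\<beta>(1) by blast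
        then have r: "M r \<in> G (e + int (Suc n) * d - 1)"
          using MG[of r "e + int n * d - 1"] by (simp add: algebra_simps)
        have "contract (\<lambda>a. \<beta> ((A ^^ (m + n)) a)) x \<in> G e"
          using m[OF fc[OF \<alpha>\<beta>(2) linear_funpow[OF A, of n]]]
          by (simp add: funpow_add add.commute[of m])
        then have "(M ^^ n) (contract (\<lambda>a. \<beta> ((A ^^ (m + n)) a)) x) \<in> G (e + int n * d)"
          by (simp add: MnG)
        moreover have "contract (\<lambda>a. \<beta> ((A ^^ m) a)) ?y
            - (M ^^ n) (contract (\<lambda>a. \<beta> ((A ^^ (m + n)) a)) x) \<in> G (e + int n * d)"
          using Suc \<alpha>\<beta>(2) mono[of "e + int n * d - 1" "e + int n * d"] by auto
        ultimately have "contract (\<lambda>a. \<beta> ((A ^^ m) a)) ?y \<in> G (e + int n * d)"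
          using v2.subspace_add[OF sub] by fastforce
        \<comment> \<open>The \<beta> term is bounded one degree less sharply than \<open>r\<close>,
          but \<open>D\<close> raises degrees by at most \<open>d - 1\<close>, which makes up for
          it.\<close>
        then have "D (contract (\<lambda>a. \<beta> ((A ^^ m) a)) ?y) \<in> G (e + int (Suc n) * d - 1)"
          using DG[of _ "e + int n * d"] by (simp add: algebra_simps)
        with r have "M r + D (contract (\<lambda>a. \<beta> ((A ^^ m) a)) ?y) \<in> G (e + int (Suc n) * d - 1)"
          by (rule v2.subspace_add[OF sub])
        moreover have "contract (\<lambda>a. \<phi> ((A ^^ m) a)) ((L ^^ Suc n) x)
            - (M ^^ Suc n) (contract (\<lambda>a. \<phi> ((A ^^ (m + Suc n)) a)) x)
          = M r + D (contract (\<lambda>a. \<beta> ((A ^^ m) a)) ?y)"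
          unfolding eq r_def by (simp add: M.diff \<alpha>_def)
        ultimately show "contract (\<lambda>a. \<phi> ((A ^^ m) a)) ((L ^^ Suc n) x)
            - (M ^^ Suc n) (contract (\<lambda>a. \<phi> ((A ^^ (m + Suc n)) a)) x)
          \<in> G (e + int (Suc n) * d - 1)" by simp
      qed
    qed
    \<comment> \<open>Since \<open>d \<ge> 1\<close>, this \<open>n\<close> brings the error bound
      up to at least the orbit bound \<open>N\<close>. The leading term then satisfies the error
      bound too, and undoing \<open>M ^^ n\<close> leaves degree at most
      \<open>e - 1\<close>.\<close>
    define n where "n = nat (N - e + 1)"
    have "N \<le> e + int n * d - 1"
    proof -
      have "N - e + 1 \<le> int n" by (simp add: n_def)
      also have "\<dots> \<le> int n * d" using mult_left_mono[OF d, of "int n"] by simp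
      finally show ?thesis by simp
    qed
    then have G: "G N \<subseteq> G (e + int n * d - 1)" by (rule mono)
    have "contract (\<lambda>a. \<phi> ((A ^^ (m + n)) a)) x \<in> G (N - int (Suc k))" if \<phi>: "functional \<phi>" for \<phi>
    proof -
      have "contract (\<lambda>a. \<phi> ((A ^^ m) a)) ((L ^^ n) x) \<in> G (e + int n * d - 1)"
        using N[of n] fc[OF \<phi> linear_funpow[OF A]] G by (auto simp: bd_def)
      then have "(M ^^ n) (contract (\<lambda>a. \<phi> ((A ^^ (m + n)) a)) x) \<in> G (e + int n * d - 1)"
        using lead[of n] \<phi> v2.subspace_diff[OF sub] by fastforce
      then show ?thesis
        using MnG[of n _ "e - 1"] by (simp add: e_def algebra_simps)
    qed
    then show ?case by blast
  qed
  \<comment> \<open>The index \<open>N - int (nat (N + 1))\<close> is negative for every integer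
    \<open>N\<close>, so \<open>G\<close> is zero there.\<close>
  obtain m where m: "contract (\<lambda>a. \<phi> ((A ^^ m) a)) x = 0" if "functional \<phi>" for \<phi>
    using desc[of "nat (N + 1)"] neg[of "N - int (nat (N + 1))"] by auto
  obtain h where h: "Vector_Spaces.linear s s h" "\<And>a b. h (t a b) = t ((A ^^ m) a) b"
    using tensor_map_exists[OF linear_funpow[OF A, of m] v2.linear_id] by (auto simp: id_def)
  have "contract \<phi> (h x) = 0" if \<phi>: "functional \<phi>" for \<phi>
  proof -
    have "Vector_Spaces.linear s s2 (\<lambda>y. contract \<phi> (h y))"
      using linear_contract[OF \<phi>] h(1) by (simp add: Vector_Spaces.linear_iff)
    then have "contract \<phi> (h x) = contract (\<lambda>a. \<phi> ((A ^^ m) a)) x"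
      by (rule linear_eqI[OF _ linear_contract])
        (simp_all add: h(2) contract_tensor \<phi> fc[OF \<phi> linear_funpow[OF A]])
    then show ?thesis using m[OF \<phi>] by simp
  qed
  then have "h x = 0" by (rule contract_separates)
  then show ?thesis using h by blast
qed

end


section \<open>Degree filtrations\<close>

locale filtered_poisson = nc_poisson_algebra scale br
  for scale :: "'k::field \<Rightarrow> 'a::ring_1 \<Rightarrow> 'a" and br :: "'a \<Rightarrow> 'a \<Rightarrow> 'a" +
  fixes u :: "'a \<Rightarrow> int extended"
  assumes degree: "degree_map br u"
    and finite_filt: "finite_filtration scale u"
    and discrete_filt: "discrete_filtration u"
    and gr_comm: "gr_bracket_commutative br u"
begin

section \<open>Behaviour of the degree under product and bracket\<close>

lemma degree_mult: "u (x * y) = u x + u y"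
  and degree_not_pinf: "u x \<noteq> \<infinity>"
  and degree_minf_iff: "u x = -\<infinity> \<longleftrightarrow> x = 0"
  and degree_br_le: "u (br x y) \<le> u x + u y"
  using degree unfolding degree_map_def by metis+

text \<open>The axioms of a degree map do not mention scalars; closure under scaling comes from each
  member of the filtration being a span.\<close>

lemma subspace_filt: "subspace (filt u k)"
  using finite_filt subspace_span unfolding finite_filtration_def finite_dim_def by metis

lemma filt_mono: "k \<le> l \<Longrightarrow> filt u k \<subseteq> filt u l"
  by (auto simp: filt_def elim: order_trans)

lemma filt_exhaustive: "\<exists>k. x \<in> filt u k"
  using degree_not_pinf[of x] by (cases "u x") (auto simp: filt_def)

lemma filt_negative: "k < 0 \<Longrightarrow> filt u k = {0}"
  using discrete_filt by (simp add: discrete_filtration_def)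

lemma no_zero_divisors:
  fixes x y :: 'a
  assumes "x * y = 0"
  shows "x = 0 \<or> y = 0"
proof -
  have "u x + u y = -\<infinity>" using assms degree_mult[of x y] degree_minf_iff[of 0] by simp
  then have "u x = -\<infinity> \<or> u y = -\<infinity>"
    using degree_not_pinf[of x] degree_not_pinf[of y] by (cases "u x"; cases "u y") auto
  then show ?thesis by (simp add: degree_minf_iff)
qed

lemma linear_mult_left: "Vector_Spaces.linear scale scale (\<lambda>y. x * y)"
  and linear_mult_right: "Vector_Spaces.linear scale scale (\<lambda>x. x * y)"
  using bilinear_mult by (simp_all add: bilinear_map_def)

lemma linear_br_right: "Vector_Spaces.linear scale scale (br x)"
  and linear_br_left: "Vector_Spaces.linear scale scale (\<lambda>x. br x y)"
  using bilinear_br by (simp_all add: bilinear_map_def)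

lemma br_one: "br x 1 = 0"
  using leibniz[of x 1 1] by simp

lemma br_antisym: "br x y = - br y x"
proof -
  have "br (x + y) (x + y) = br x x + br x y + (br y x + br y y)"
    using linear_br_right linear_br_left by (simp add: Vector_Spaces.linear_iff)
  then show ?thesis by (simp add: br_self eq_neg_iff_add_eq_0)
qed

text \<open>Degrees add exactly, so a factor \<open>z\<close> can also be cancelled from a degree
  bound.\<close>

lemma filt_mult_left_iff: "u z = Fin d \<Longrightarrow> z * y \<in> filt u (k + d) \<longleftrightarrow> y \<in> filt u k"
  and filt_mult_right_iff: "u z = Fin d \<Longrightarrow> y * z \<in> filt u (k + d) \<longleftrightarrow> y \<in> filt u k"
  by (cases "u y"; auto simp: filt_def degree_mult)+

text \<open>The class of \<open>br x y\<close> in degree \<open>i + j\<close> is the graded bracket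
  of the classes of \<open>x\<close> and \<open>y\<close>; its vanishing gains one degree.\<close>

lemma br_filt:
  assumes "x \<in> filt u i" "y \<in> filt u j"
  shows "br x y \<in> filt u (i + j - 1)"
proof -
  have coset0: "gr_zero u k = gr_coset u k 0" for k by (auto simp: gr_zero_def gr_coset_def)
  have carrier: "gr_homogeneous u k a \<in> gr_carrier u" if "a \<in> filt u k" for k a
  proof -
    have "{i. gr_homogeneous u k a i \<noteq> gr_zero u i} \<subseteq> {k}"
      by (auto simp: gr_homogeneous_def split: if_splits)
    then have "finite {i. gr_homogeneous u k a i \<noteq> gr_zero u i}"
      by (rule finite_subset) simp
    moreover have "gr_homogeneous u k a i \<in> gr_coset u i ` filt u i" for i
      using that filt_zero[OF degree, of i] by (simp add: gr_homogeneous_def coset0)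
    ultimately show ?thesis by (simp add: gr_carrier_def)
  qed
  have "gr_homogeneous u (i + j) (br x y) = gr_op u br (gr_homogeneous u i x) (gr_homogeneous u j y)"
  proof (rule gr_op_homogeneous[OF degree, symmetric])
    show "br (x - x') y = br x y - br x' y" for x x' y
    proof -
      interpret Vector_Spaces.linear scale scale "\<lambda>x. br x y" by (rule linear_br_left)
      show ?thesis by (rule diff)
    qed
    show "br x (y - y') = br x y - br x y'" for x y y'
    proof -
      interpret Vector_Spaces.linear scale scale "br x" by (rule linear_br_right)
      show ?thesis by (rule diff)
    qed
  qed (use assms degree_br_le in auto)
  also have "\<dots> = gr_zero u"
    using gr_comm carrier assms by (simp add: gr_bracket_commutative_def)
  finally have "gr_coset u (i + j) (br x y) = gr_coset u (i + j) 0"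
    by (metis coset0 fun_upd_same gr_homogeneous_def)
  then show ?thesis using gr_coset_eq_iff[OF degree] by fastforce
qed

end

section \<open>Scalars in degree zero and positive degree of noncentral elements\<close>

text \<open>The degree-zero part is a finite dimensional domain over an algebraically closed field.\<close>

lemma (in filtered_poisson) filt_0_scalar:
  fixes x :: 'a
  assumes alg_closed: "\<And>p :: 'k poly. degree p > 0 \<Longrightarrow> \<exists>c. poly p c = 0"
    and x: "x \<in> filt u 0"
  shows "\<exists>c. x = scale c 1"
proof -
  let ?ev = "\<lambda>p. poly_endo_apply scale p ((*) x) 1"
  note vs = vector_space_axioms
  interpret Lx: Vector_Spaces.linear scale scale "(*) x" by (rule linear_mult_left)
  have pow: "((*) x ^^ n) 1 = x ^ n" for n by (induction n) auto
  have u1: "u 1 = Fin 0"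
    using degree_mult[of 1 1] degree_not_pinf[of 1] degree_minf_iff[of 1] by (cases "u 1") auto
  have pow0: "x ^ n \<in> filt u 0" for n
  proof (induction n)
    case 0
    show ?case by (simp add: filt_def u1)
  next
    case (Suc n)
    show ?case
    proof (cases "x = 0")
      case False
      then obtain d where d: "u x = Fin d"
        using degree_minf_iff[of x] degree_not_pinf[of x] by (cases "u x") auto
      have "x ^ Suc n \<in> filt u (0 + d)" using filt_mult_left_iff[OF d, of "x ^ n" 0] Suc by simp
      moreover have "d \<le> 0" using x d by (simp add: filt_def)
      ultimately show ?thesis using filt_mono[of "0 + d" 0] by auto
    qed (simp add: filt_zero[OF degree])
  qed
  have "\<exists>p. p \<noteq> 0 \<and> ?ev p = 0"
  proof -
    obtain B where B: "finite B" "span B = filt u 0"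
      using finite_filt unfolding finite_filtration_def finite_dim_def by blast
    show ?thesis
    \<comment> \<open>Two coinciding powers give an annihilating difference of monomials. Otherwise
      there are \<open>Suc (card B)\<close> distinct powers in the span of \<open>B\<close>, hence a
      linear dependence.\<close>
    proof (cases "inj_on (\<lambda>n. x ^ n) {..card B}")
      case False
      then obtain i j where ij: "i \<noteq> j" "x ^ i = x ^ j" by (auto simp: inj_on_def)
      let ?p = "monom 1 i + smult (-1) (monom 1 j) :: 'k poly"
      have "coeff ?p i \<noteq> 0" using ij by simp
      moreover have "?ev ?p = 0"
        using ij by (simp only: poly_endo_apply_add[OF vs] poly_endo_apply_smult[OF vs]
            poly_endo_apply_monom[OF vs] pow) simp
      ultimately show ?thesis by (metis coeff_0)
    next
      case inj: True
      let ?S = "(\<lambda>n. x ^ n) ` {..card B}"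
      have "card ?S = Suc (card B)" using card_image[OF inj] by simp
      moreover have "?S \<subseteq> span B" using pow0 B by auto
      ultimately have "dependent ?S"
        using independent_span_bound[OF B(1), of ?S] by force
      then obtain c where c: "\<exists>v\<in>?S. c v \<noteq> 0" "(\<Sum>v\<in>?S. scale (c v) v) = 0"
        using dependent_finite[of ?S] by auto
      \<comment> \<open>The dependence is indexed by the powers as vectors; injectivity lets it be
        reindexed by exponents.\<close>
      let ?p = "\<Sum>i\<le>card B. monom (c (x ^ i)) i"
      have co: "coeff ?p i = (if i \<le> card B then c (x ^ i) else 0)" for i
        by (simp add: coeff_sum)
      have "degree ?p \<le> card B" by (rule degree_le) (simp add: co)
      then have "?ev ?p = (\<Sum>i\<le>card B. scale (coeff ?p i) (x ^ i))"
        by (simp add: poly_endo_apply_superset[OF vs] pow)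
      also have "\<dots> = (\<Sum>i\<le>card B. scale (c (x ^ i)) (x ^ i))"
        by (rule sum.cong) (auto simp: co)
      also have "\<dots> = 0" using c(2) by (simp add: sum.reindex[OF inj])
      finally have "?ev ?p = 0" .
      moreover obtain i where "i \<le> card B" "c (x ^ i) \<noteq> 0" using c(1) by auto
      then have "coeff ?p i \<noteq> 0" by (simp add: co)
      then have "?p \<noteq> 0" by (metis coeff_0)
      ultimately show ?thesis by blast
    qed
  qed
  then obtain p where "p \<noteq> 0" "?ev p = 0" by blast
  \<comment> \<open>Linear factors are split off: for a root \<open>c\<close> of \<open>p\<close>,
    either \<open>x\<close> is the scalar \<open>c\<close> or the cofactor \<open>q\<close> still
    annihilates, as there are no zero divisors.\<close>
  then show ?thesis
  proof (induction "degree p" arbitrary: p rule: less_induct)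
    case less
    show ?case
    proof (cases "degree p = 0")
      case True
      \<comment> \<open>A nonzero constant polynomial evaluates to a nonzero multiple of
        \<open>1\<close>, so this case is contradictory.\<close>
      then obtain a where "p = [:a:]" by (auto elim: degree_eq_zeroE)
      then show ?thesis
        using less by (simp add: poly_endo_apply_pCons[OF linear_mult_left] poly_endo_apply_0[OF vs])
    next
      case False
      then obtain c where "poly p c = 0" using alg_closed[of p] by auto
      then obtain q where q: "p = [:- c, 1:] * q" using poly_eq_0_iff_dvd by blast
      have q0: "q \<noteq> 0" using q less.prems by auto
      have "degree q < degree p" using q q0 degree_mult_eq[of "[:- c, 1:]" q] by simp
      moreover have "?ev p = (x - scale c 1) * ?ev q"
      proof -
        interpret Rq: Vector_Spaces.linear scale scale "\<lambda>y. y * ?ev q" by (rule linear_mult_right)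
        have "p = smult (- c) q + pCons 0 q" using q by simp
        then have "?ev p = scale (- c) (?ev q) + x * ?ev q"
          by (simp only: poly_endo_apply_add[OF vs] poly_endo_apply_smult[OF vs]
              poly_endo_apply_pCons[OF linear_mult_left]) simp
        then show ?thesis using Rq.scale[of c 1] by (simp add: left_diff_distrib)
      qed
      ultimately show ?thesis
        using less.hyps[of q] less.prems q0 no_zero_divisors by fastforce
    qed
  qed
qed

text \<open>Scalars are central for both product and bracket, so by \<open>filt_0_scalar\<close> the
  element \<open>z\<close> lies outside \<open>filt u 0\<close>.\<close>

lemma (in filtered_poisson) degree_noncentral:
  assumes "\<And>p :: 'k poly. degree p > 0 \<Longrightarrow> \<exists>c. poly p c = 0" and z: "z \<notin> poisson_center br"
  obtains d where "u z = Fin d" "d \<ge> 1"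
proof -
  have "z \<notin> filt u 0"
  proof
    assume "z \<in> filt u 0"
    then obtain c where c: "z = scale c 1" using filt_0_scalar assms(1) by blast
    have "scale c 1 * w = w * scale c 1" for w
      using linear_mult_right[of w] linear_mult_left[of w] by (simp add: Vector_Spaces.linear_iff)
    moreover have "br (scale c 1) w = 0" for w
      using linear_br_left[of w] br_one[of w] br_antisym[of 1 w]
      by (simp add: Vector_Spaces.linear_iff)
    ultimately show False using z c by (simp add: poisson_center_def)
  qed
  then show ?thesis
    using that degree_not_pinf[of z] by (cases "u z") (auto simp: filt_def)
qed


section \<open>The tensor product\<close>

lemma tensor_product_generated:
  assumes "tensor_product s1 s2 s t"
  shows "tensor_subspace s t UNIV UNIV = UNIV"
proof -
  interpret vector_space s using assms by (simp add: tensor_product_def)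
  have "x \<in> tensor_subspace s t UNIV UNIV" for x
  proof -
    obtain p where "x = free_extend s t p" using assms by (auto simp: tensor_product_def)
    also have "\<dots> \<in> tensor_subspace s t UNIV UNIV"
      unfolding free_extend_def tensor_subspace_def
      by (intro span_sum span_scale span_base) auto
    finally show ?thesis .
  qed
  then show ?thesis by blast
qed

lemma bilinear_map_swap: "bilinear_map s1 s2 s3 f \<Longrightarrow> bilinear_map s2 s1 s3 (\<lambda>b a. f a b)"
  by (simp add: bilinear_map_def)

text \<open>The version with exchanged factors lets results about the first factor be applied to the
  second.\<close>

lemma tensor_product_imp_tensor_space:
  assumes "vector_space s1" "vector_space s2" and T: "tensor_product s1 s2 s t"
  shows "tensor_space s1 s2 s t" and "tensor_space s2 s1 s (\<lambda>b a. t a b)"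
proof -
  interpret v1: vector_space s1 by fact
  interpret v2: vector_space s2 by fact
  interpret v: vector_space s using T by (simp add: tensor_product_def)
  have ex: "\<exists>g. Vector_Spaces.linear s s3 g \<and> (\<forall>a b. g (t a b) = f a b)"
    if "bilinear_map s1 s2 s3 f" for s3 f
    using tensor_product_universal[OF T that] by blast
  have bil: "bilinear_map s1 s2 s t" by (rule tensor_product_bilinear) fact+
  show "tensor_space s1 s2 s t"
    by unfold_locales (rule bil tensor_product_generated[OF T] ex, assumption?)+
  have "tensor_subspace s (\<lambda>b a. t a b) UNIV UNIV = tensor_subspace s t UNIV UNIV"
    unfolding tensor_subspace_def by (rule arg_cong[where f = "module.span s"]) auto
  then have gen: "tensor_subspace s (\<lambda>b a. t a b) UNIV UNIV = UNIV"
    using tensor_product_generated[OF T] by simp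
  have ex': "\<exists>g. Vector_Spaces.linear s s3 g \<and> (\<forall>b a. g (t a b) = f b a)"
    if "bilinear_map s2 s1 s3 f" for s3 f
    using ex[OF bilinear_map_swap[OF that]] by blast
  show "tensor_space s2 s1 s (\<lambda>b a. t a b)"
    by unfold_locales (rule bilinear_map_swap[OF bil] gen ex', assumption?)+
qed

text \<open>For Class 2, inserting \<open>t (a * z1) (z2 * b)\<close> with both signs into the
  commutator puts it into the form that defines the bracket for Class 1.\<close>

lemma poisson_tensor_bracket:
  assumes "nc_poisson_algebra s1 br1" "nc_poisson_algebra s2 br2"
    and cl: "(poisson_class1 s1 br1 \<and> poisson_class1 s2 br2) \<or>
         (poisson_class2 s1 br1 \<and> poisson_class2 s2 br2)"
    and T: "poisson_tensor_product s1 br1 s2 br2 s br t"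
  shows "br (t z1 z2) (t a b) = t (br1 z1 a) (z2 * b) + t (a * z1) (br2 z2 b)"
proof -
  interpret p1: nc_poisson_algebra s1 br1 by fact
  interpret p2: nc_poisson_algebra s2 br2 by fact
  interpret T: tensor_space s1 s2 s t
    using T by (intro tensor_product_imp_tensor_space)
      (auto simp: poisson_tensor_product_def p1.vector_space_axioms p2.vector_space_axioms)
  from cl show ?thesis
  proof
    assume "poisson_class1 s1 br1 \<and> poisson_class1 s2 br2"
    then show ?thesis using T by (simp add: poisson_tensor_product_def)
  next
    assume *: "poisson_class2 s1 br1 \<and> poisson_class2 s2 br2"
    have m: "t c d * t c' d' = t (c * c') (d * d')" for c d c' d'
      using T by (simp add: poisson_tensor_product_def)
    have "br (t z1 z2) (t a b) = t z1 z2 * t a b - t a b * t z1 z2"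
      using T * unfolding poisson_tensor_product_def by blast
    moreover have "br1 z1 a = z1 * a - a * z1" "br2 z2 b = z2 * b - b * z2"
      using * by (auto simp: poisson_class2_def)
    ultimately show ?thesis by (simp add: m T.left.diff T.right.diff)
  qed
qed

text \<open>Each application of \<open>br \<Theta>\<close> lowers the nilpotency exponent of one
  factor; \<open>B\<close> and \<open>M\<close> commute with the adjoint maps and hence do not raise
  the other. The induction is on the sum of the two exponents.\<close>

lemma (in tensor_space) tensor_subspace_N_set_subset:
  assumes A: "Vector_Spaces.linear s1 s1 (br1 z1)" and D: "Vector_Spaces.linear s2 s2 (br2 z2)"
    and AB: "\<And>a. br1 z1 (B a) = B (br1 z1 a)" and B0: "B 0 = 0"
    and DM: "\<And>b. br2 z2 (M b) = M (br2 z2 b)" and M0: "M 0 = 0"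
    and L: "Vector_Spaces.linear s s (br \<Theta>)"
      "\<And>a b. br \<Theta> (t a b) = t (br1 z1 a) (M b) + t (B a) (br2 z2 b)"
  shows "tensor_subspace s t (N_set br1 z1) (N_set br2 z2) \<subseteq> N_set br \<Theta>"
proof -
  have Ln: "Vector_Spaces.linear s s (br \<Theta> ^^ n)" for n by (rule linear_funpow[OF L(1)])
  interpret L: Vector_Spaces.linear s s "br \<Theta> ^^ n" for n by (rule Ln)
  have commB: "(br1 z1 ^^ n) (B a) = B ((br1 z1 ^^ n) a)" for n a by (induction n) (simp_all add: AB)
  have commM: "(br2 z2 ^^ n) (M b) = M ((br2 z2 ^^ n) b)" for n b by (induction n) (simp_all add: DM)
  have tens: "(br \<Theta> ^^ (p + q)) (t a b) = 0"
    if "(br1 z1 ^^ p) a = 0" "(br2 z2 ^^ q) b = 0" for p q a b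
    using that
  proof (induction "p + q" arbitrary: p q a b)
    case 0
    then show ?case by (simp add: left.zero)
  next
    case (Suc n)
    show ?case
    proof (cases "p = 0 \<or> q = 0")
      case True
      then show ?thesis using Suc.prems by (auto simp: left.zero right.zero L.zero)
    next
      case False
      then obtain p' q' where pq: "p = Suc p'" "q = Suc q'" by (metis not0_implies_Suc)
      have "(br \<Theta> ^^ (p' + q)) (t (br1 z1 a) (M b)) = 0"
        using Suc.hyps(2) Suc.prems pq
        by (intro Suc.hyps(1)) (simp_all add: DM commM M0 funpow_swap1 del: funpow.simps add: funpow_Suc_right)
      moreover have "(br \<Theta> ^^ (p + q')) (t (B a) (br2 z2 b)) = 0"
        using Suc.hyps(2) Suc.prems pq
        by (intro Suc.hyps(1)) (simp_all add: AB commB B0 funpow_swap1 del: funpow.simps add: funpow_Suc_right)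
      moreover have "p + q = Suc (p' + q)" "p' + q = p + q'" using pq by auto
      ultimately show ?thesis
        by (simp only: funpow_Suc_right comp_apply L(2) L.add) simp
    qed
  qed
  have "v.subspace (N_set br \<Theta>)"
    unfolding v.subspace_def
  proof (intro conjI ballI allI)
    show "0 \<in> N_set br \<Theta>" by (auto simp: N_set_def L.zero)
    fix x assume "x \<in> N_set br \<Theta>"
    then obtain m where m: "(br \<Theta> ^^ m) x = 0" by (auto simp: N_set_def)
    then show "s c x \<in> N_set br \<Theta>" for c
      unfolding N_set_def by (auto simp: L.scale intro!: exI[of _ m])
    fix y assume "y \<in> N_set br \<Theta>"
    then obtain n where n: "(br \<Theta> ^^ n) y = 0" by (auto simp: N_set_def)
    have "(br \<Theta> ^^ (n + m)) x = (br \<Theta> ^^ n) ((br \<Theta> ^^ m) x)"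
      by (simp only: funpow_add comp_apply)
    moreover have "(br \<Theta> ^^ (n + m)) y = (br \<Theta> ^^ m) ((br \<Theta> ^^ n) y)"
      by (simp only: funpow_add comp_apply add.commute[of n])
    ultimately have "(br \<Theta> ^^ (n + m)) (x + y) = 0" by (simp add: L.add m n L.zero)
    then show "x + y \<in> N_set br \<Theta>" unfolding N_set_def by blast
  qed
  then show ?thesis
    unfolding tensor_subspace_def
    by (rule v.span_minimal[rotated]) (use tens in \<open>unfold N_set_def, blast\<close>)
qed

text \<open>An eigenvector spans its own orbit, so it lies in \<open>F_set\<close> and is killed by
  a power of \<open>br z\<close>; the eigenvalue is thus nilpotent, hence zero. The vector
  \<open>v\<close> shows that zero does occur.\<close>

lemma Ev_set_D_set_of_locally_nilpotent:
  fixes s :: "'k::field \<Rightarrow> 't::ab_group_add \<Rightarrow> 't"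
  assumes L: "Vector_Spaces.linear s s (br z)" and F: "F_set s br z = N_set br z"
    and v: "v \<noteq> 0" "br z v = 0"
  shows "Ev_set s br z = {0}" "D_set s br z = C_set br z"
proof -
  interpret L: Vector_Spaces.linear s s "br z" by fact
  have "l = 0" if l: "l \<in> Ev_set s br z" for l
  proof -
    obtain x where x: "x \<noteq> 0" "br z x = s l x" using l by (auto simp: Ev_set_def)
    have pow: "(br z ^^ n) x = s (l ^ n) x" for n
      by (induction n) (auto simp: x L.scale mult.commute)
    have "x \<in> F_set s br z"
    proof -
      have "L.vs1.span {x} = range (\<lambda>p. poly_endo_apply s p (br z) x)"
        unfolding range_poly_endo_apply[OF L.vs1.vector_space_axioms]
      proof (rule L.vs1.span_eq[THEN iffD2], intro conjI subsetI)
        fix y assume "y \<in> {x}"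
        then have "y = (br z ^^ 0) x" by simp
        then show "y \<in> L.vs1.span (range (\<lambda>n. (br z ^^ n) x))"
          by (metis L.vs1.span_base rangeI)
      qed (auto simp: pow intro: L.vs1.span_scale L.vs1.span_base)
      then show ?thesis unfolding F_set_def finite_dim_def by blast
    qed
    then obtain m where "(br z ^^ m) x = 0" by (auto simp: F N_set_def)
    then show "l = 0" using x by (simp add: pow)
  qed
  moreover have "0 \<in> Ev_set s br z" using v by (auto simp: Ev_set_def)
  ultimately show Ev: "Ev_set s br z = {0}" by blast
  have "L.vs1.subspace (C_set br z)"
    by (rule L.vs1.subspaceI) (auto simp: C_set_def L.zero L.add L.scale)
  then show "D_set s br z = C_set br z"
    by (simp add: D_set_def Ev C_set_def L.vs1.span_eq_iff)
qed

section \<open>The sets attached to a tensor of two noncentral elements\<close>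

theorem theorem5p6:
  fixes s1 :: "'k::{alg_closed_field, field_char_0} \<Rightarrow> 'a::ring_1 \<Rightarrow> 'a"
    and s2 :: "'k \<Rightarrow> 'b::ring_1 \<Rightarrow> 'b"
    and s :: "'k \<Rightarrow> 't::ring_1 \<Rightarrow> 't"
    and br1 :: "'a \<Rightarrow> 'a \<Rightarrow> 'a" and br2 :: "'b \<Rightarrow> 'b \<Rightarrow> 'b" and br :: "'t \<Rightarrow> 't \<Rightarrow> 't"
    and tens :: "'a \<Rightarrow> 'b \<Rightarrow> 't"
    and u1 :: "'a \<Rightarrow> int extended" and u2 :: "'b \<Rightarrow> int extended"
    and z1 :: 'a and z2 :: 'b and \<Theta> :: 't
  assumes "nc_poisson_algebra s1 br1" and "nc_poisson_algebra s2 br2"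
    and "(poisson_class1 s1 br1 \<and> poisson_class1 s2 br2) \<or>
         (poisson_class2 s1 br1 \<and> poisson_class2 s2 br2)"
    and "poisson_tensor_product s1 br1 s2 br2 s br tens"
    and "degree_map br1 u1" and "\<And>x. u1 x = -\<infinity> \<or> 0 \<le> u1 x"
    and "degree_map br2 u2" and "\<And>y. u2 y = -\<infinity> \<or> 0 \<le> u2 y"
    and "finite_filtration s1 u1" and "discrete_filtration u1"
    and "finite_filtration s2 u2" and "discrete_filtration u2"
    and "gr_bracket_commutative br1 u1" and "gr_bracket_commutative br2 u2"
    and "z1 \<notin> poisson_center br1" and "z2 \<notin> poisson_center br2"
    and "\<Theta> = tens z1 z2"
  shows "F_set s br \<Theta> = N_set br \<Theta> \<and>
    N_set br \<Theta> = tensor_subspace s tens (N_set br1 z1) (N_set br2 z2) \<and>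
    D_set s br \<Theta> = C_set br \<Theta> \<and>
    Ev_set s br \<Theta> = {0}"
proof -
  interpret p1: filtered_poisson s1 br1 u1
    using assms(1,5,9,10,13) by (simp add: filtered_poisson_def filtered_poisson_axioms_def)
  interpret p2: filtered_poisson s2 br2 u2
    using assms(2,7,11,12,14) by (simp add: filtered_poisson_def filtered_poisson_axioms_def)
  have T: "tensor_product s1 s2 s tens" "tens 1 1 = 1" "bilinear_map s s s br"
    using assms(4) unfolding poisson_tensor_product_def by blast+
  interpret T: tensor_space s1 s2 s tens
    by (rule tensor_product_imp_tensor_space(1)[OF p1.vector_space_axioms p2.vector_space_axioms T(1)])
  interpret S: tensor_space s2 s1 s "\<lambda>b a. tens a b"
    by (rule tensor_product_imp_tensor_space(2)[OF p1.vector_space_axioms p2.vector_space_axioms T(1)])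
  obtain d1 where d1: "u1 z1 = Fin d1" "d1 \<ge> 1" using p1.degree_noncentral[OF alg_closed_imp_poly_has_root assms(15)] .
  obtain d2 where d2: "u2 z2 = Fin d2" "d2 \<ge> 1" using p2.degree_noncentral[OF alg_closed_imp_poly_has_root assms(16)] .
  have L: "Vector_Spaces.linear s s (br \<Theta>)" using T(3) by (simp add: bilinear_map_def)
  have ad: "br \<Theta> (tens a b) = tens (br1 z1 a) (z2 * b) + tens (a * z1) (br2 z2 b)" for a b
    unfolding assms(17) by (rule poisson_tensor_bracket[OF assms(1-4)])
  \<comment> \<open>The bracket of an element with itself is zero, so by the Leibniz rule its
    adjoint map commutes with multiplication by it.\<close>
  have comm: "br1 z1 (a * z1) = br1 z1 a * z1" "br2 z2 (z2 * b) = z2 * br2 z2 b" for a b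
    by (simp_all add: p1.leibniz p2.leibniz p1.br_self p2.br_self)
  let ?NN = "tensor_subspace s tens (N_set br1 z1) (N_set br2 z2)"
  have F_NN: "F_set s br \<Theta> \<subseteq> ?NN"
  proof
    fix x assume "x \<in> F_set s br \<Theta>"
    then have x: "finite_dim s (range (\<lambda>p. poly_endo_apply s p (br \<Theta>) x))"
      by (simp add: F_set_def)
    have D1: "br1 z1 y \<in> filt u1 (k + d1 - 1)" if "y \<in> filt u1 k" for y k
      using p1.br_filt[of z1 d1 y k] that d1 by (simp add: filt_def add.commute)
    have D2: "br2 z2 y \<in> filt u2 (k + d2 - 1)" if "y \<in> filt u2 k" for y k
      using p2.br_filt[of z2 d2 y k] that d2 by (simp add: filt_def add.commute)
    \<comment> \<open>Degrees are measured in the second factor, where multiplication by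
      \<open>z2\<close> dominates \<open>br2 z2\<close>.\<close>
    obtain m1 h1 where h1: "Vector_Spaces.linear s s h1"
      "\<And>a b. h1 (tens a b) = tens ((br1 z1 ^^ m1) a) b" "h1 x = 0"
      using T.locally_finite_imp_left_nilpotent[of "filt u2" "br1 z1" "\<lambda>a. a * z1"
          "\<lambda>b. z2 * b" "br2 z2" d2 "br \<Theta>" x, OF p2.subspace_filt p2.filt_mono p2.filt_exhaustive
          p2.filt_negative p1.linear_br_right p1.linear_mult_right comm(1) p2.linear_mult_left
          p2.linear_br_right p2.filt_mult_left_iff[OF d2(1)] D2 d2(2) L ad x]
      by blast
    \<comment> \<open>With the factors exchanged, degrees are measured in the first factor and the
      summands of \<open>ad\<close> trade places.\<close>
    obtain m2 h2 where h2: "Vector_Spaces.linear s s h2"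
      "\<And>a b. h2 (tens a b) = tens a ((br2 z2 ^^ m2) b)" "h2 x = 0"
      using S.locally_finite_imp_left_nilpotent[of "filt u1" "br2 z2" "\<lambda>b. z2 * b"
          "\<lambda>a. a * z1" "br1 z1" d1 "br \<Theta>" x, OF p1.subspace_filt p1.filt_mono p1.filt_exhaustive
          p1.filt_negative p2.linear_br_right p2.linear_mult_left comm(2) p1.linear_mult_right
          p1.linear_br_right p1.filt_mult_right_iff[OF d1(1)] D1 d1(2) L
          ad[unfolded add.commute[of "tens (br1 z1 a) (z2 * b)" for a b]] x]
      by blast
    have "x \<in> tensor_subspace s tens {a. (br1 z1 ^^ m1) a = 0} {b. (br2 z2 ^^ m2) b = 0}"
      by (rule T.tensor_kernels[OF linear_funpow[OF p1.linear_br_right]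
            linear_funpow[OF p2.linear_br_right] h1 h2])
    also have "\<dots> \<subseteq> ?NN"
      unfolding tensor_subspace_def by (rule T.v.span_mono) (auto simp: N_set_def)
    finally show "x \<in> ?NN" .
  qed
  have NN_N: "?NN \<subseteq> N_set br \<Theta>"
    by (rule T.tensor_subspace_N_set_subset[where B = "\<lambda>a. a * z1" and M = "\<lambda>b. z2 * b"])
      (simp_all add: p1.linear_br_right p2.linear_br_right comm L ad)
  have N_F: "N_set br \<Theta> \<subseteq> F_set s br \<Theta>"
    by (rule N_set_subset_F_set) (rule T.v.vector_space_axioms L)+
  have FN: "F_set s br \<Theta> = N_set br \<Theta>" using F_NN NN_N N_F by blast
  \<comment> \<open>The unit \<open>tens 1 1\<close> serves as the nonzero eigenvector for
    eigenvalue zero.\<close>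
  have "br \<Theta> 1 = 0"
    using ad[of 1 1] by (simp add: T(2) p1.br_one p2.br_one T.left.zero T.right.zero)
  then have "Ev_set s br \<Theta> = {0}" "D_set s br \<Theta> = C_set br \<Theta>"
    using Ev_set_D_set_of_locally_nilpotent[of s br \<Theta> 1] L FN by auto
  then show ?thesis using F_NN NN_N FN by blast
qed

end
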